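(* Let $G$ and $H$ be groups with symmetric generating sets $X$ and $Y$ respectively, and let $\Lambda$ and $\Gamma$ be finite alphabets. If $(G,X,\Lambda)$ is $\mathscr S_k$-graph automatic and $(H,Y,\Gamma)$ is $\mathscr S_l$-graph automatic, then the free product $G\ast H$ is $\mathscr S_{\max\{k,l\}}$-graph automatic.
   Context: A generating set is symmetric if it is closed under inverses; it need not be finite. A normal form for $(G,X,\Lambda)$ is a set $L\subseteq\Lambda^*$ in bijection with $G$; the image of $u\in L$ is denoted $\overline u$. Convolution: let $\diamond\notin\Lambda$ and $\Lambda_\diamond=\Lambda\cup\{\diamond\}$. For $u,v\in\Lambda^*$, $\otimes(u,v)$ is the word of length $\max(|u|,|v|)$ over $(\Lambda_\diamond)^2$ whose $i$th letter has first component the $i$th letter of $u$ if $i\le|u|$ and $\diamond$ otherwise, and second component the $i$th letter of $v$ if $i\le|v|$ and $\diamond$ otherwise. For a class $\mathcal C$ of formal languages, $(G,X,\Lambda)$ is $\mathcal C$-graph automatic if there is a normal form $L\subseteq\Lambda^*$ in $\mathcal C$ such that for each $x\in X$ the language $L_x=\{\otimes(u,v)\mid u,v\in L,\ \overline v=_G\overline u x\}$ is in $\mathcal C$. A group is called $\mathcal C$-graph automatic if it is so for some symmetric generating set and some finite alphabet. Counter automata: a non-blind $k$-counter automaton is a finite state automaton augmented with $k$ integer counters, all initialized to zero, which can be incremented, decremented, compared to zero and set to zero during operation; it accepts a word exactly if it reaches an accepting state with all counters equal to zero. It is non-deterministic if from each state there can be multiple transitions labeled by the same input letter, and transitions labeled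 by $\epsilon$ that read no input letter. It runs in quasi-realtime if there is a bound on the number of consecutive $\epsilon$ transitions allowed. $\mathscr S_k$ is the class of languages accepted by non-blind non-deterministic $k$-counter automata running in quasi-realtime. *)

theory Defs
  imports "HOL-Algebra.Generated_Groups"
begin

section \<open>Counter automata\<close>

datatype instr =
    Inc nat | Dec nat | Reset nat
  | Test_neg nat | Test_zero nat | Test_pos nat

type_synonym counters = "nat \<Rightarrow> int"

primrec counter_of :: "instr \<Rightarrow> nat" where
  "counter_of (Inc i) = i"
| "counter_of (Dec i) = i"
| "counter_of (Reset i) = i"
| "counter_of (Test_neg i) = i"
| "counter_of (Test_zero i) = i"
| "counter_of (Test_pos i) = i"

text \<open>A failed comparison blocks the transition (result \<open>None\<close>). A test for being nonzero is
  a nondeterministic choice between \<open>Test_neg\<close> and \<open>Test_pos\<close>.\<close>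

primrec exec_instr :: "instr \<Rightarrow> counters \<Rightarrow> counters option" where
  "exec_instr (Inc i) c = Some (c(i := c i + 1))"
| "exec_instr (Dec i) c = Some (c(i := c i - 1))"
| "exec_instr (Reset i) c = Some (c(i := 0))"
| "exec_instr (Test_neg i) c = (if c i < 0 then Some c else None)"
| "exec_instr (Test_zero i) c = (if c i = 0 then Some c else None)"
| "exec_instr (Test_pos i) c = (if c i > 0 then Some c else None)"

primrec exec_instrs :: "instr list \<Rightarrow> counters \<Rightarrow> counters option" where
  "exec_instrs [] c = Some c"
| "exec_instrs (i # is) c = Option.bind (exec_instr i c) (exec_instrs is)"

text \<open>A transition \<open>(p, a, is, q)\<close> leads from state \<open>p\<close> to state \<open>q\<close>, reads the letter \<open>x\<close> if
  \<open>a = Some x\<close> and is an epsilon transition if \<open>a = None\<close>, and executes the counter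
  instructions \<open>is\<close> in order.\<close>

record ('s, 'a) counter_automaton =
  states :: "'s set"
  start :: 's
  accepting :: "'s set"
  transitions :: "('s \<times> 'a option \<times> instr list \<times> 's) set"

text \<open>Finiteness of the set of transitions makes the set of letters that can be read finite.\<close>

definition counter_automaton :: "nat \<Rightarrow> ('s, 'a) counter_automaton \<Rightarrow> bool" where
  "counter_automaton k M \<longleftrightarrow>
     finite (states M) \<and> start M \<in> states M \<and> accepting M \<subseteq> states M \<and>
     finite (transitions M) \<and>
     (\<forall>(p, a, is, q) \<in> transitions M.
        p \<in> states M \<and> q \<in> states M \<and> (\<forall>i \<in> set is. counter_of i < k))"

definition step ::
  "('s, 'a) counter_automaton \<Rightarrow> 'a option \<Rightarrow> 's \<times> counters \<Rightarrow> 's \<times> counters \<Rightarrow> bool" where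
  "step M a cf cf' \<longleftrightarrow>
     (\<exists>is. (fst cf, a, is, fst cf') \<in> transitions M \<and> exec_instrs is (snd cf) = Some (snd cf'))"

inductive run ::
  "('s, 'a) counter_automaton \<Rightarrow> 's \<times> counters \<Rightarrow> 'a list \<Rightarrow> 's \<times> counters \<Rightarrow> bool"
  for M where
  run_refl: "run M cf [] cf"
| run_epsilon: "step M None cf cf' \<Longrightarrow> run M cf' w cf'' \<Longrightarrow> run M cf w cf''"
| run_letter: "step M (Some a) cf cf' \<Longrightarrow> run M cf' w cf'' \<Longrightarrow> run M cf (a # w) cf''"

definition start_config :: "('s, 'a) counter_automaton \<Rightarrow> 's \<times> counters" where
  "start_config M = (start M, \<lambda>_. 0)"

definition accepted_language :: "nat \<Rightarrow> ('s, 'a) counter_automaton \<Rightarrow> 'a list set" where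
  "accepted_language k M =
     {w. \<exists>q c. run M (start_config M) w (q, c) \<and> q \<in> accepting M \<and> (\<forall>i<k. c i = 0)}"

definition quasi_realtime :: "('s, 'a) counter_automaton \<Rightarrow> bool" where
  "quasi_realtime M \<longleftrightarrow>
     (\<exists>B. \<forall>w cf cf' n.
        run M (start_config M) w cf \<longrightarrow> (step M None ^^ n) cf cf' \<longrightarrow> n \<le> B)"

text \<open>Taking natural numbers as states is no restriction, since state sets are finite.\<close>

definition counter_languages :: "nat \<Rightarrow> 'a list set set" where
  "counter_languages k =
     {accepted_language k M | M :: (nat, 'a) counter_automaton.
        counter_automaton k M \<and> quasi_realtime M}"

section \<open>Graph automatic groups\<close>

text \<open>The padding symbol is \<open>None\<close>.\<close>

definition convolution :: "'a list \<Rightarrow> 'a list \<Rightarrow> ('a option \<times> 'a option) list" where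
  "convolution u v =
     map (\<lambda>i. (if i < length u then Some (u ! i) else None,
               if i < length v then Some (v ! i) else None))
       [0..<max (length u) (length v)]"

definition symmetric_generating_set :: "('g, 'm) monoid_scheme \<Rightarrow> 'g set \<Rightarrow> bool" where
  "symmetric_generating_set G X \<longleftrightarrow>
     X \<subseteq> carrier G \<and> (\<forall>x \<in> X. inv\<^bsub>G\<^esub> x \<in> X) \<and> generate G X = carrier G"

text \<open>\<open>\<phi>\<close> is the bijection between the normal form \<open>L\<close> and the group.\<close>

definition normal_form ::
  "('g, 'm) monoid_scheme \<Rightarrow> 'a set \<Rightarrow> 'a list set \<Rightarrow> ('a list \<Rightarrow> 'g) \<Rightarrow> bool" where
  "normal_form G \<Lambda> L \<phi> \<longleftrightarrow> L \<subseteq> lists \<Lambda> \<and> bij_betw \<phi> L (carrier G)"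

text \<open>Graph automaticity of the triple \<open>(G, X, \<Lambda>)\<close> for the class \<open>counter_languages k\<close>. The
  class is not a parameter because it is used both for words over \<open>\<Lambda>\<close> and for convolutions,
  that is, at two different types.\<close>

definition counter_graph_automatic ::
  "nat \<Rightarrow> ('g, 'm) monoid_scheme \<Rightarrow> 'g set \<Rightarrow> 'a set \<Rightarrow> bool" where
  "counter_graph_automatic k G X \<Lambda> \<longleftrightarrow>
     (\<exists>L \<phi>. normal_form G \<Lambda> L \<phi> \<and> L \<in> counter_languages k \<and>
        (\<forall>x \<in> X. {convolution u v | u v. u \<in> L \<and> v \<in> L \<and> \<phi> v = \<phi> u \<otimes>\<^bsub>G\<^esub> x}
                   \<in> counter_languages k))"

text \<open>Every finite alphabet can be renamed to a finite set of natural numbers.\<close>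

definition counter_graph_automatic_group :: "nat \<Rightarrow> ('g, 'm) monoid_scheme \<Rightarrow> bool" where
  "counter_graph_automatic_group k G \<longleftrightarrow>
     group G \<and>
     (\<exists>X (\<Lambda> :: nat set). symmetric_generating_set G X \<and> finite \<Lambda> \<and>
        counter_graph_automatic k G X \<Lambda>)"

section \<open>Free products\<close>

text \<open>Elements of the free product are the reduced words: sequences of nontrivial elements of
  the two factors in which neighbouring syllables come from different factors.\<close>

primrec syllable ::
  "('g, 'm) monoid_scheme \<Rightarrow> ('h, 'n) monoid_scheme \<Rightarrow> 'g + 'h \<Rightarrow> bool" where
  "syllable G H (Inl g) \<longleftrightarrow> g \<in> carrier G \<and> g \<noteq> \<one>\<^bsub>G\<^esub>"
| "syllable G H (Inr h) \<longleftrightarrow> h \<in> carrier H \<and> h \<noteq> \<one>\<^bsub>H\<^esub>"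

definition reduced_words ::
  "('g, 'm) monoid_scheme \<Rightarrow> ('h, 'n) monoid_scheme \<Rightarrow> ('g + 'h) list set" where
  "reduced_words G H =
     {w. (\<forall>s \<in> set w. syllable G H s) \<and> successively (\<lambda>s t. isl s \<noteq> isl t) w}"

text \<open>Multiply a reduced word on the left by a single syllable and reduce.\<close>

fun syllable_mult ::
  "('g, 'm) monoid_scheme \<Rightarrow> ('h, 'n) monoid_scheme \<Rightarrow> 'g + 'h \<Rightarrow> ('g + 'h) list \<Rightarrow> ('g + 'h) list"
where
  "syllable_mult G H (Inl g) (Inl g' # w) =
     (if g \<otimes>\<^bsub>G\<^esub> g' = \<one>\<^bsub>G\<^esub> then w else Inl (g \<otimes>\<^bsub>G\<^esub> g') # w)"
| "syllable_mult G H (Inr h) (Inr h' # w) =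
     (if h \<otimes>\<^bsub>H\<^esub> h' = \<one>\<^bsub>H\<^esub> then w else Inr (h \<otimes>\<^bsub>H\<^esub> h') # w)"
| "syllable_mult G H s w = s # w"

definition free_product ::
  "('g, 'm) monoid_scheme \<Rightarrow> ('h, 'n) monoid_scheme \<Rightarrow> ('g + 'h) list monoid" where
  "free_product G H =
     \<lparr>carrier = reduced_words G H,
      monoid.mult = \<lambda>u v. foldr (syllable_mult G H) u v,
      one = []\<rparr>"

lemma reduced_words_Nil [simp]: "[] \<in> reduced_words G H"
  by (simp add: reduced_words_def)

lemma reduced_words_Cons:
  "s # w \<in> reduced_words G H \<longleftrightarrow>
     syllable G H s \<and> w \<in> reduced_words G H \<and> (w = [] \<or> isl s \<noteq> isl (hd w))"
  by (cases w) (auto simp: reduced_words_def)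

lemma syllable_mult_closed:
  assumes "group G" "group H" "syllable G H s" "w \<in> reduced_words G H"
  shows "syllable_mult G H s w \<in> reduced_words G H"
proof -
  interpret G: group G by fact
  interpret H: group H by fact
  show ?thesis using assms(3,4)
    by (cases "(G, H, s, w)" rule: syllable_mult.cases) (auto simp: reduced_words_Cons)
qed

lemma foldr_syllable_mult_closed:
  assumes "group G" "group H" "u \<in> reduced_words G H" "v \<in> reduced_words G H"
  shows "foldr (syllable_mult G H) u v \<in> reduced_words G H"
  using assms(3) by (induction u) (auto simp: reduced_words_Cons assms syllable_mult_closed)

lemma syllable_mult_Inl:
  assumes "group G" "group H" "g \<in> carrier G" "g' \<in> carrier G" "g \<noteq> \<one>\<^bsub>G\<^esub>" "g' \<noteq> \<one>\<^bsub>G\<^esub>"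
    "w \<in> reduced_words G H"
  shows "syllable_mult G H (Inl g) (syllable_mult G H (Inl g') w) =
     (if g \<otimes>\<^bsub>G\<^esub> g' = \<one>\<^bsub>G\<^esub> then w else syllable_mult G H (Inl (g \<otimes>\<^bsub>G\<^esub> g')) w)"
proof -
  interpret G: group G by fact
  show ?thesis
  proof (cases "\<exists>g'' v. w = Inl g'' # v")
    case False
    then have *: "syllable_mult G H (Inl a) w = Inl a # w" for a
      by (cases w; cases "hd w") auto
    show ?thesis by (simp add: *)
  next
    case True
    then obtain g'' v where w: "w = Inl g'' # v" by blast
    with assms have g'': "g'' \<in> carrier G" "g'' \<noteq> \<one>\<^bsub>G\<^esub>" and v: "v = [] \<or> \<not> isl (hd v)"
      by (auto simp: reduced_words_Cons)
    from v have *: "syllable_mult G H (Inl a) v = Inl a # v" for a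
      by (cases v; cases "hd v") auto
    have 1: "g = g \<otimes>\<^bsub>G\<^esub> g' \<otimes>\<^bsub>G\<^esub> g''" if "g' \<otimes>\<^bsub>G\<^esub> g'' = \<one>\<^bsub>G\<^esub>"
      using that assms g'' by (simp add: G.m_assoc)
    have 2: "g'' = g \<otimes>\<^bsub>G\<^esub> (g' \<otimes>\<^bsub>G\<^esub> g'')" if "g \<otimes>\<^bsub>G\<^esub> g' = \<one>\<^bsub>G\<^esub>"
      using that assms g'' by (simp flip: G.m_assoc)
    show ?thesis
      using assms g'' 1 2 by (auto simp: w * G.m_assoc)
  qed
qed

lemma syllable_mult_Inr:
  assumes "group G" "group H" "g \<in> carrier H" "g' \<in> carrier H" "g \<noteq> \<one>\<^bsub>H\<^esub>" "g' \<noteq> \<one>\<^bsub>H\<^esub>"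
    "w \<in> reduced_words G H"
  shows "syllable_mult G H (Inr g) (syllable_mult G H (Inr g') w) =
     (if g \<otimes>\<^bsub>H\<^esub> g' = \<one>\<^bsub>H\<^esub> then w else syllable_mult G H (Inr (g \<otimes>\<^bsub>H\<^esub> g')) w)"
proof -
  interpret G: group H by fact
  show ?thesis
  proof (cases "\<exists>g'' v. w = Inr g'' # v")
    case False
    then have *: "syllable_mult G H (Inr a) w = Inr a # w" for a
      by (cases w; cases "hd w") auto
    show ?thesis by (simp add: *)
  next
    case True
    then obtain g'' v where w: "w = Inr g'' # v" by blast
    with assms have g'': "g'' \<in> carrier H" "g'' \<noteq> \<one>\<^bsub>H\<^esub>" and v: "v = [] \<or> isl (hd v)"
      by (auto simp: reduced_words_Cons)
    from v have *: "syllable_mult G H (Inr a) v = Inr a # v" for a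
      by (cases v; cases "hd v") auto
    have 1: "g = g \<otimes>\<^bsub>H\<^esub> g' \<otimes>\<^bsub>H\<^esub> g''" if "g' \<otimes>\<^bsub>H\<^esub> g'' = \<one>\<^bsub>H\<^esub>"
      using that assms g'' by (simp add: G.m_assoc)
    have 2: "g'' = g \<otimes>\<^bsub>H\<^esub> (g' \<otimes>\<^bsub>H\<^esub> g'')" if "g \<otimes>\<^bsub>H\<^esub> g' = \<one>\<^bsub>H\<^esub>"
      using that assms g'' by (simp flip: G.m_assoc)
    show ?thesis
      using assms g'' 1 2 by (auto simp: w * G.m_assoc)
  qed
qed

lemma foldr_syllable_mult_syllable:
  assumes "group G" "group H" "syllable G H s"
    and "v \<in> reduced_words G H" "w \<in> reduced_words G H"
  shows "foldr (syllable_mult G H) (syllable_mult G H s v) w =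
     syllable_mult G H s (foldr (syllable_mult G H) v w)"
proof (cases "(G, H, s, v)" rule: syllable_mult.cases)
  case (1 G' H' g g' v')
  with assms show ?thesis
    using syllable_mult_Inl[of G H g g' "foldr (syllable_mult G H) v' w"]
      foldr_syllable_mult_closed[of G H v' w]
    by (auto simp: reduced_words_Cons)
next
  case (2 G' H' g g' v')
  with assms show ?thesis
    using syllable_mult_Inr[of G H g g' "foldr (syllable_mult G H) v' w"]
      foldr_syllable_mult_closed[of G H v' w]
    by (auto simp: reduced_words_Cons)
qed auto

lemma foldr_syllable_mult_assoc:
  assumes "group G" "group H"
    and "u \<in> reduced_words G H" "v \<in> reduced_words G H" "w \<in> reduced_words G H"
  shows "foldr (syllable_mult G H) (foldr (syllable_mult G H) u v) w =
     foldr (syllable_mult G H) u (foldr (syllable_mult G H) v w)"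
  using assms(3)
  by (induction u)
     (auto simp: reduced_words_Cons foldr_syllable_mult_syllable foldr_syllable_mult_closed assms)

lemma foldr_syllable_mult_Nil:
  assumes "u \<in> reduced_words G H"
  shows "foldr (syllable_mult G H) u [] = u"
  using assms
proof (induction u)
  case (Cons s u)
  then show ?case
    by (cases "(G, H, s, u)" rule: syllable_mult.cases) (auto simp: reduced_words_Cons)
qed simp

theorem group_free_product:
  assumes "group G" and "group H"
  shows "group (free_product G H)"
proof -
  interpret G: group G by fact
  interpret H: group H by fact
  have inv: "\<exists>v \<in> reduced_words G H. foldr (syllable_mult G H) v u = []"
    if "u \<in> reduced_words G H" for u
    using that
  proof (induction u)
    case (Cons s u)
    then obtain v where v: "v \<in> reduced_words G H" "foldr (syllable_mult G H) v u = []"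
      by (auto simp: reduced_words_Cons)
    define t where "t = (case s of Inl g \<Rightarrow> Inl (inv\<^bsub>G\<^esub> g) | Inr h \<Rightarrow> Inr (inv\<^bsub>H\<^esub> h))"
    have t: "[t] \<in> reduced_words G H" "syllable_mult G H t (s # u) = u"
      using Cons.prems by (auto simp: t_def reduced_words_Cons split: sum.splits)
    have "foldr (syllable_mult G H) (foldr (syllable_mult G H) v [t]) (s # u) = []"
      using foldr_syllable_mult_assoc[OF assms v(1) t(1) Cons.prems] t v by simp
    then show ?case
      using foldr_syllable_mult_closed[OF assms v(1) t(1)] by blast
  qed (auto intro!: bexI[of _ "[]"])
  show ?thesis
    by (rule groupI)
       (use inv in \<open>auto simp: free_product_def assms foldr_syllable_mult_closed
          foldr_syllable_mult_assoc\<close>)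
qed

end

theory Submission imports Defs begin

text \<open>
  Right multiplication by an element of one factor changes at most the last syllable of a reduced
  word. This suggests to represent a reduced word by the concatenation of the normal forms of its
  syllables, each preceded by a letter that marks its factor (\<open>word_code\<close>). The free product is
  generated by the nontrivial elements of \<open>X\<close> and \<open>Y\<close>. For a generator of one factor, the convolution
  of the representatives of \<open>w\<close> and of its product with the generator consists of a diagonal part,
  coming from the common prefix, and of a word that is known from this factor: either the convolution of
  two nontrivial normal forms that differ by the generator, or, when a syllable appears or disappears, one
  fixed word padded on one side (\<open>right_multiplication_in_counter_languages\<close>).

  It remains to see that such languages are recognised without additional counters. All of them
  consist of the labels of paths in a finite graph whose edges carry a marker and a counter
  language (\<open>marked_path_language_in_counter_languages\<close>). A single automaton follows the path and
  simulates, edge after edge, an automaton for the language of the edge. Because acceptance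
  requires all counters to be zero, the edges can share the counters: it suffices to test for zero at the
  end of each edge. This is why the maximum of \<open>k\<close> and \<open>l\<close> is enough, rather than their sum. The markers
  force a letter to be read on each edge, so that the automaton runs in quasi-realtime.

  The identity is represented by the empty word, while the normal form of each factor represents it by
  some word of its own. That word must not occur as a syllable, for which closure under
  removal of finitely many words is used (\<open>counter_languages_Diff_finite\<close>).
\<close>

section \<open>Runs of counter automata\<close>

lemma run_append:
  assumes "run M cf u cf'" "run M cf' v cf''"
  shows "run M cf (u @ v) cf''"
  using assms by (induction rule: run.induct) (auto intro: run.intros)

lemma run_single_epsilon: "step M None cf cf' \<Longrightarrow> run M cf [] cf'"
  by (blast intro: run.intros)

lemma run_single_letter: "step M (Some a) cf cf' \<Longrightarrow> run M cf [a] cf'"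
  by (blast intro: run.intros)

text \<open>Runs are built from their first step, so an induction over a run cannot refer to the word read
  so far. Here the invariant \<open>I v cf\<close> carries that word, which makes statements about all
  configurations reachable from the start provable one step at a time.\<close>

lemma run_invariant:
  assumes "run M cf w cf'" and "I v cf"
    and "\<And>v cf cf'. I v cf \<Longrightarrow> step M None cf cf' \<Longrightarrow> I v cf'"
    and "\<And>v a cf cf'. I v cf \<Longrightarrow> step M (Some a) cf cf' \<Longrightarrow> I (v @ [a]) cf'"
  shows "I (v @ w) cf'"
  using assms(1,2)
proof (induction arbitrary: v rule: run.induct)
  case (run_epsilon cf cf' w cf'')
  then show ?case using assms(3) by blast
next
  case (run_letter a cf cf' w cf'')
  then show ?case using assms(4)[of v cf a cf'] run_letter.IH[of "v @ [a]"] by simp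
qed simp

lemma exec_instrs_unused_counter:
  assumes "exec_instrs is c = Some c'" "\<forall>i \<in> set is. counter_of i < k" "k \<le> j"
  shows "c' j = c j"
  using assms
proof (induction "is" arbitrary: c)
  case (Cons i "is")
  then obtain d where d: "exec_instr i c = Some d" "exec_instrs is d = Some c'"
    by (auto split: bind_splits)
  have "d j = c j"
    using d(1) Cons.prems by (cases i) (auto split: if_splits)
  then show ?case using Cons d by auto
qed simp

lemma exec_instrs_Test_zero:
  "exec_instrs (map Test_zero is) c = (if \<forall>i \<in> set is. c i = 0 then Some c else None)"
  by (induction "is") auto

lemma step_unused_counter:
  assumes "step M a cf cf'" "counter_automaton k M" "k \<le> j"
  shows "snd cf' j = snd cf j"
proof -
  obtain "is" where "(fst cf, a, is, fst cf') \<in> transitions M"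
    and ex: "exec_instrs is (snd cf) = Some (snd cf')"
    using assms(1) by (auto simp: step_def)
  then have "\<forall>i \<in> set is. counter_of i < k"
    using assms(2) unfolding counter_automaton_def by blast
  with ex show ?thesis using exec_instrs_unused_counter assms(3) by blast
qed

lemma run_unused_counter:
  assumes "run M cf w cf'" "counter_automaton k M" "k \<le> j"
  shows "snd cf' j = snd cf j"
  using assms by (induction rule: run.induct) (auto dest: step_unused_counter)

text \<open>Counters outside the range of the automaton keep their initial value, so an accepting run ends
  in the one configuration with all counters zero. This is what lets accepting runs be chained
  and shows that nothing changes when more counters are allowed.\<close>

lemma accepted_language_zero_counters:
  assumes "counter_automaton k M"
  shows "accepted_language k M = {w. \<exists>q \<in> accepting M. run M (start_config M) w (q, \<lambda>_. 0)}"
proof -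
  have "c = (\<lambda>_. 0)" if "run M (start_config M) w (q, c)" "\<forall>i<k. c i = 0" for w q c
  proof
    fix i
    show "c i = 0"
      using run_unused_counter[OF that(1) assms, of i] that(2)
      by (cases "i < k") (auto simp: start_config_def)
  qed
  then show ?thesis
    by (fastforce simp: accepted_language_def)
qed

lemma counter_languages_mono:
  assumes "k \<le> K"
  shows "counter_languages k \<subseteq> counter_languages K"
proof
  fix L :: "'a list set"
  assume "L \<in> counter_languages k"
  then obtain M :: "(nat, 'a) counter_automaton"
    where M: "L = accepted_language k M" "counter_automaton k M" "quasi_realtime M"
    by (auto simp: counter_languages_def)
  from M(2) assms have M': "counter_automaton K M"
    by (fastforce simp: counter_automaton_def)
  moreover have "L = accepted_language K M"
    using M by (simp add: accepted_language_zero_counters[OF M'] accepted_language_zero_counters[OF M(2)])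
  ultimately show "L \<in> counter_languages K"
    unfolding counter_languages_def using M(3) by blast
qed

lemma quasi_realtimeE:
  assumes "quasi_realtime M"
  obtains B where "\<And>w cf cf' n. run M (start_config M) w cf \<Longrightarrow> (step M None ^^ n) cf cf' \<Longrightarrow> n \<le> B"
  using assms unfolding quasi_realtime_def by blast

text \<open>If every step of \<open>M'\<close> projects to a step of \<open>M\<close>, then so does every run, and chains of epsilon
  steps keep their length. A construction that only decorates the states of \<open>M\<close> or relabels its
  letters therefore inherits the bound that makes \<open>M\<close> quasi-realtime.\<close>

lemma run_projection:
  assumes "\<And>a cf cf'. step M' a cf cf' \<Longrightarrow> \<exists>b. map_option f b = a \<and> step M b (\<pi> cf) (\<pi> cf')"
    and "run M' cf w cf'"
  shows "\<exists>v. map f v = w \<and> run M (\<pi> cf) v (\<pi> cf')"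
  using assms(2)
proof (induction rule: run.induct)
  case (run_refl cf)
  then show ?case by (auto intro: run.intros)
next
  case (run_epsilon cf cf' w cf'')
  then show ?case using assms(1)[of None cf cf'] by (auto intro: run.intros)
next
  case (run_letter a cf cf' w cf'')
  from assms(1)[OF run_letter.hyps(1)] obtain b where b: "f b = a" "step M (Some b) (\<pi> cf) (\<pi> cf')"
    by auto
  from run_letter.IH obtain v where "map f v = w" "run M (\<pi> cf') v (\<pi> cf'')"
    by blast
  with b show ?case by (intro exI[of _ "b # v"]) (auto intro: run.intros)
qed

lemma quasi_realtime_projection:
  assumes proj: "\<And>a cf cf'. step M' a cf cf' \<Longrightarrow> \<exists>b. map_option f b = a \<and> step M b (\<pi> cf) (\<pi> cf')"
    and start: "\<pi> (start_config M') = start_config M"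
    and M: "quasi_realtime M"
  shows "quasi_realtime M'"
proof -
  obtain B where
    B: "\<And>w cf cf' n. run M (start_config M) w cf \<Longrightarrow> (step M None ^^ n) cf cf' \<Longrightarrow> n \<le> B"
    using quasi_realtimeE[OF M] by blast
  have eps: "(step M None ^^ n) (\<pi> cf) (\<pi> cf')" if "(step M' None ^^ n) cf cf'" for n cf cf'
    using that
  proof (induction n arbitrary: cf')
    case (Suc n)
    then obtain cf1 where "(step M' None ^^ n) cf cf1" "step M' None cf1 cf'" by auto
    moreover have "step M None (\<pi> cf1) (\<pi> cf')"
      using proj[OF calculation(2)] by simp
    ultimately show ?case using Suc.IH[of cf1] by (simp add: relcomppI)
  qed auto
  show ?thesis
    unfolding quasi_realtime_def
  proof (intro exI allI impI)
    fix w cf cf' n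
    assume "run M' (start_config M') w cf" and n: "(step M' None ^^ n) cf cf'"
    then obtain v where "run M (start_config M) v (\<pi> cf)"
      using run_projection[where f = f and \<pi> = \<pi> and M = M and M' = M', OF proj] start by metis
    then show "n \<le> B" using B eps[OF n] by blast
  qed
qed

section \<open>Closure properties of counter languages\<close>

text \<open>Relabelling the transitions of \<open>M\<close> by \<open>f\<close> yields the image language even if \<open>f\<close> is not injective,
  since a nondeterministic automaton guesses the preimage of each letter. The states are numbered
  at the same time, so later constructions may use any convenient type of states.\<close>

lemma image_accepted_language_in_counter_languages:
  fixes M :: "('s, 'a) counter_automaton" and f :: "'a \<Rightarrow> 'b"
  assumes M: "counter_automaton k M" and "quasi_realtime M"
  shows "map f ` accepted_language k M \<in> counter_languages k"
proof -
  from M have "finite (states M)" by (simp add: counter_automaton_def)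
  then obtain e :: "'s \<Rightarrow> nat" where e: "inj_on e (states M)"
    using finite_imp_inj_to_nat_seg by metis
  define M' where "M' = \<lparr>states = e ` states M, start = e (start M), accepting = e ` accepting M,
     transitions = (\<lambda>(p, a, is, q). (e p, map_option f a, is, e q)) ` transitions M\<rparr>"
  have M': "counter_automaton k M'"
    using M unfolding counter_automaton_def M'_def by fastforce
  define \<pi> :: "nat \<times> counters \<Rightarrow> 's \<times> counters"
    where "\<pi> = map_prod (inv_into (states M) e) id"
  have \<pi>: "\<pi> (e p, c) = (p, c)" if "p \<in> states M" for p c
    using e that by (simp add: \<pi>_def)
  have tr: "p \<in> states M \<and> q \<in> states M" if "(p, a, is, q) \<in> transitions M" for p a "is" q
    using M that by (fastforce simp: counter_automaton_def)
  have proj: "\<exists>b. map_option f b = a \<and> step M b (\<pi> cf) (\<pi> cf')" if st: "step M' a cf cf'" for a cf cf'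
  proof -
    obtain p b "is" q c c' where *: "(p, b, is, q) \<in> transitions M" "a = map_option f b"
        "cf = (e p, c)" "cf' = (e q, c')" "exec_instrs is c = Some c'"
      using st unfolding step_def M'_def by (cases cf; cases cf') auto
    with tr[OF *(1)] have "step M b (\<pi> cf) (\<pi> cf')"
      by (auto simp: step_def \<pi>)
    with *(2) show ?thesis by blast
  qed
  have lift: "step M' (map_option f a) (map_prod e id cf) (map_prod e id cf')"
    if "step M a cf cf'" for a cf cf'
    using that unfolding step_def M'_def by (cases cf; cases cf') (auto intro: rev_image_eqI)
  have lift_run: "run M' (map_prod e id cf) (map f w) (map_prod e id cf')"
    if "run M cf w cf'" for w cf cf'
    using that
  proof (induction rule: run.induct)
    case (run_epsilon cf cf' w cf'')
    from lift[OF run_epsilon.hyps(1)] have "step M' None (map_prod e id cf) (map_prod e id cf')"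
      by simp
    then show ?case using run_epsilon.IH by (rule run.run_epsilon)
  next
    case (run_letter a cf cf' w cf'')
    from lift[OF run_letter.hyps(1)]
    have "step M' (Some (f a)) (map_prod e id cf) (map_prod e id cf')" by simp
    then show ?case unfolding list.map using run_letter.IH by (rule run.run_letter)
  qed (simp add: run.run_refl)
  have start: "\<pi> (start_config M') = start_config M"
    using M \<pi> by (simp add: start_config_def M'_def counter_automaton_def)
  have "accepted_language k M' = map f ` accepted_language k M"
    unfolding accepted_language_zero_counters[OF M] accepted_language_zero_counters[OF M']
  proof (intro equalityI subsetI)
    fix w assume "w \<in> {w. \<exists>q\<in>accepting M'. run M' (start_config M') w (q, \<lambda>_. 0)}"
    then obtain q where q: "q \<in> accepting M" "run M' (start_config M') w (e q, \<lambda>_. 0)"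
      by (auto simp: M'_def)
    moreover have "q \<in> states M"
      using q(1) M by (auto simp: counter_automaton_def)
    ultimately obtain v where "map f v = w" "run M (start_config M) v (q, \<lambda>_. 0)"
      using run_projection[where f = f and \<pi> = \<pi> and M = M and M' = M', OF proj q(2)]
      by (auto simp: start \<pi>)
    with q(1) show "w \<in> map f ` {w. \<exists>q\<in>accepting M. run M (start_config M) w (q, \<lambda>_. 0)}"
      by blast
  next
    fix w assume "w \<in> map f ` {w. \<exists>q\<in>accepting M. run M (start_config M) w (q, \<lambda>_. 0)}"
    then obtain v q where "w = map f v" "q \<in> accepting M" "run M (start_config M) v (q, \<lambda>_. 0)"
      by blast
    moreover have "map_prod e id (start_config M) = start_config M'"
      by (simp add: start_config_def M'_def)
    ultimately have "run M' (start_config M') w (e q, \<lambda>_. 0)" "e q \<in> accepting M'"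
      using lift_run[of "start_config M" v "(q, \<lambda>_. 0)"] by (simp_all add: M'_def)
    then show "w \<in> {w. \<exists>q\<in>accepting M'. run M' (start_config M') w (q, \<lambda>_. 0)}"
      by blast
  qed
  moreover have "quasi_realtime M'"
    using quasi_realtime_projection[of M' f M \<pi>, OF proj start assms(2)] by blast
  ultimately show ?thesis
    unfolding counter_languages_def using M' by blast
qed

lemma accepted_language_in_counter_languages:
  assumes "counter_automaton k M" "quasi_realtime M"
  shows "accepted_language k M \<in> counter_languages k"
  using image_accepted_language_in_counter_languages[OF assms, of "\<lambda>x. x"] by simp

lemma counter_languagesE:
  fixes L :: "'a list set"
  assumes "L \<in> counter_languages k"
  obtains M :: "(nat, 'a) counter_automaton"
    where "counter_automaton k M" "quasi_realtime M" "L = accepted_language k M"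
  using assms by (auto simp: counter_languages_def)

lemma counter_languages_image:
  assumes "L \<in> counter_languages k"
  shows "map f ` L \<in> counter_languages k"
  using assms image_accepted_language_in_counter_languages by (metis counter_languagesE)

lemma Nil_language_in_counter_languages: "{[]} \<in> counter_languages k"
proof -
  define M :: "(nat, 'a) counter_automaton"
    where "M = \<lparr>states = {0}, start = 0, accepting = {0}, transitions = {}\<rparr>"
  have no_step: "\<not> step M a cf cf'" for a cf cf'
    by (simp add: step_def M_def)
  have run: "run M cf w cf' \<longleftrightarrow> w = [] \<and> cf' = cf" for cf w cf'
    using no_step by (auto intro: run.intros elim: run.cases)
  have "n \<le> 0" if "(step M None ^^ n) cf cf'" for n cf cf'
    using that by (cases n) (auto simp only: relpowp.simps no_step OO_def)
  then have "quasi_realtime M" unfolding quasi_realtime_def by blast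
  moreover have "counter_automaton k M" by (simp add: counter_automaton_def M_def)
  moreover have "accepted_language k M = {[]}"
    by (auto simp: accepted_language_def run start_config_def) (simp add: M_def)+
  ultimately show ?thesis using accepted_language_in_counter_languages by metis
qed

text \<open>A product construction: the deterministic automaton \<open>\<delta>\<close> runs along in the states, ignores epsilon
  transitions and uses no counter.\<close>

lemma counter_languages_Int_dfa:
  fixes L :: "'a list set" and \<delta> :: "'d \<Rightarrow> 'a \<Rightarrow> 'd"
  assumes L: "L \<in> counter_languages k"
    and D: "finite D" "d0 \<in> D" "\<And>d a. d \<in> D \<Longrightarrow> \<delta> d a \<in> D"
  shows "{w \<in> L. foldl \<delta> d0 w \<in> F} \<in> counter_languages k"
proof -
  obtain M :: "(nat, 'a) counter_automaton"
    where M: "counter_automaton k M" "quasi_realtime M" "L = accepted_language k M"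
    using counter_languagesE[OF L] .
  define \<delta>' where "\<delta>' d a = (case a of None \<Rightarrow> d | Some x \<Rightarrow> \<delta> d x)" for d a
  define M' where "M' = \<lparr>states = states M \<times> D, start = (start M, d0),
     accepting = accepting M \<times> (F \<inter> D),
     transitions = (\<lambda>((p, a, is, q), d). ((p, d), a, is, (q, \<delta>' d a))) ` (transitions M \<times> D)\<rparr>"
  have M': "counter_automaton k M'"
  proof -
    have "\<delta>' d a \<in> D" if "d \<in> D" for d a
      using D(3) that by (auto simp: \<delta>'_def split: option.splits)
    then show ?thesis
      using M(1) D(1,2) unfolding counter_automaton_def M'_def by fastforce
  qed
  have step: "step M' a ((p, d), c) ((q, d'), c') \<longleftrightarrow>
      step M a (p, c) (q, c') \<and> d \<in> D \<and> d' = \<delta>' d a" for a p d c q d' c'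
    by (auto simp: step_def M'_def image_iff) force+
  define \<pi> :: "(nat \<times> 'd) \<times> counters \<Rightarrow> nat \<times> counters" where "\<pi> = map_prod fst id"
  have proj: "\<exists>b. map_option (\<lambda>x. x) b = a \<and> step M b (\<pi> cf) (\<pi> cf')" if "step M' a cf cf'" for a cf cf'
    using that by (cases cf; cases cf'; cases "fst cf"; cases "fst cf'") (auto simp: step \<pi>_def option.map_ident intro!: exI[of _ a])
  have start: "\<pi> (start_config M') = start_config M"
    by (simp add: \<pi>_def start_config_def M'_def)
  have lift: "run M' ((p, d), c) w ((q, foldl \<delta> d w), c')"
    if "run M (p, c) w (q, c')" "d \<in> D" for p c w q c' d
    using that
  proof (induction "(p, c)" w "(q, c')" arbitrary: p c d rule: run.induct)
    case run_refl
    then show ?case by (simp add: run.intros)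
  next
    case (run_epsilon cf w)
    obtain r b where cf: "cf = (r, b)" by force
    have "run M' ((r, d), b) w ((q, foldl \<delta> d w), c')"
      using run_epsilon cf by blast
    moreover have "step M' None ((p, d), c) ((r, d), b)"
      using run_epsilon cf by (simp add: step \<delta>'_def)
    ultimately show ?case by (rule run.run_epsilon[rotated])
  next
    case (run_letter a cf w)
    obtain r b where cf: "cf = (r, b)" by force
    have "run M' ((r, \<delta> d a), b) w ((q, foldl \<delta> (\<delta> d a) w), c')"
      using run_letter cf D(3) by blast
    moreover have "step M' (Some a) ((p, d), c) ((r, \<delta> d a), b)"
      using run_letter cf by (simp add: step \<delta>'_def)
    ultimately show ?case by (auto intro: run.run_letter)
  qed
  have track: "snd (fst cf') = foldl \<delta> (snd (fst cf)) w" if "run M' cf w cf'" for cf w cf'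
    using that by (induction rule: run.induct) (force simp: step \<delta>'_def)+
  have "accepted_language k M' = {w \<in> L. foldl \<delta> d0 w \<in> F}"
    unfolding M(3) accepted_language_zero_counters[OF M(1)] accepted_language_zero_counters[OF M']
  proof (intro equalityI subsetI)
    fix w assume "w \<in> {w. \<exists>q\<in>accepting M'. run M' (start_config M') w (q, \<lambda>_. 0)}"
    then obtain q d where q: "q \<in> accepting M" "d \<in> F" "run M' (start_config M') w ((q, d), \<lambda>_. 0)"
      by (auto simp: M'_def)
    have "run M (start_config M) w (q, \<lambda>_. 0)"
      using run_projection[where f = "\<lambda>x. x" and \<pi> = \<pi> and M = M and M' = M', OF proj q(3)]
      unfolding start by (simp add: \<pi>_def)
    moreover have "d = foldl \<delta> d0 w"
      using track[OF q(3)] by (simp add: start_config_def M'_def)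
    ultimately show "w \<in> {w \<in> {w. \<exists>q\<in>accepting M. run M (start_config M) w (q, \<lambda>_. 0)}. foldl \<delta> d0 w \<in> F}"
      using q by blast
  next
    fix w assume "w \<in> {w \<in> {w. \<exists>q\<in>accepting M. run M (start_config M) w (q, \<lambda>_. 0)}. foldl \<delta> d0 w \<in> F}"
    then obtain q where q: "q \<in> accepting M" "run M (start_config M) w (q, \<lambda>_. 0)" "foldl \<delta> d0 w \<in> F"
      by blast
    have "foldl \<delta> d w \<in> D" if "d \<in> D" for d
      using that by (induction w arbitrary: d) (auto simp: D(3))
    then have "(q, foldl \<delta> d0 w) \<in> accepting M'"
      using q D(2) by (simp add: M'_def)
    moreover have "run M' (start_config M') w ((q, foldl \<delta> d0 w), \<lambda>_. 0)"
      using lift q(2) D(2) by (simp add: start_config_def M'_def)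
    ultimately show "w \<in> {w. \<exists>q\<in>accepting M'. run M' (start_config M') w (q, \<lambda>_. 0)}"
      by blast
  qed
  moreover have "quasi_realtime M'"
    using quasi_realtime_projection[of M' "\<lambda>x. x" M \<pi>, OF proj start M(2)] by blast
  ultimately show ?thesis
    using accepted_language_in_counter_languages[OF M'] by simp
qed

text \<open>Membership in a finite set is decided by the deterministic automaton whose states are the left
  quotients of the set; there are finitely many because they consist of suffixes of its words.\<close>

lemma counter_languages_Diff_finite:
  fixes L :: "'a list set"
  assumes "L \<in> counter_languages k" "finite S"
  shows "L - S \<in> counter_languages k"
proof -
  define \<delta> :: "'a list set \<Rightarrow> 'a \<Rightarrow> 'a list set" where "\<delta> T a = {v. a # v \<in> T}" for T a
  define D where "D = Pow {v. \<exists>u. u @ v \<in> S}"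
  have "{v. \<exists>u. u @ v \<in> S} \<subseteq> (\<Union>w \<in> S. (\<lambda>i. drop i w) ` {..length w})"
  proof clarify
    fix u v assume "u @ v \<in> S"
    moreover have "v = drop (length u) (u @ v)" "length u \<in> {..length (u @ v)}" by auto
    ultimately show "v \<in> (\<Union>w \<in> S. (\<lambda>i. drop i w) ` {..length w})" by blast
  qed
  then have "finite D"
    unfolding D_def using assms(2) by (simp add: finite_subset)
  moreover have "S \<in> D"
    unfolding D_def by (auto intro: exI[of _ "[]"])
  moreover have "\<delta> T a \<in> D" if T: "T \<in> D" for T a
  proof -
    have "\<exists>u. u @ v \<in> S" if av: "a # v \<in> T" for v
    proof -
      obtain u where "u @ a # v \<in> S"
        using av T unfolding D_def by blast
      then show ?thesis by (intro exI[of _ "u @ [a]"]) simp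
    qed
    then show ?thesis by (auto simp: D_def \<delta>_def)
  qed
  ultimately have "{w \<in> L. foldl \<delta> S w \<in> {T. [] \<notin> T}} \<in> counter_languages k"
    by (rule counter_languages_Int_dfa[OF assms(1)])
  moreover have "foldl \<delta> T w = {v. w @ v \<in> T}" for T w
    by (induction w arbitrary: T) (auto simp: \<delta>_def)
  ultimately show ?thesis by (simp add: set_diff_eq)
qed

section \<open>Languages of paths in graphs labelled by counter languages\<close>

type_synonym ('v, 'a) marked_edge = "'v \<times> 'a \<times> 'a list set \<times> 'v"

abbreviation edge_source :: "('v, 'a) marked_edge \<Rightarrow> 'v" where
  "edge_source e \<equiv> fst e"
abbreviation edge_letter :: "('v, 'a) marked_edge \<Rightarrow> 'a" where
  "edge_letter e \<equiv> fst (snd e)"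
abbreviation edge_language :: "('v, 'a) marked_edge \<Rightarrow> 'a list set" where
  "edge_language e \<equiv> fst (snd (snd e))"
abbreviation edge_target :: "('v, 'a) marked_edge \<Rightarrow> 'v" where
  "edge_target e \<equiv> snd (snd (snd e))"

text \<open>Passing an edge reads its letter followed by some word of its language. Every edge thus costs at
  least one letter, even if its language contains the empty word; this is what keeps chains of
  epsilon transitions short when automata are joined around a cycle.\<close>

inductive marked_path ::
  "('v, 'a) marked_edge set \<Rightarrow> 'v \<Rightarrow> 'a list \<Rightarrow> 'v \<Rightarrow> bool"
  for E where
  marked_path_Nil: "marked_path E p [] p"
| marked_path_edge: "(p, c, L, q) \<in> E \<Longrightarrow> u \<in> L \<Longrightarrow> marked_path E q w r \<Longrightarrow>
     marked_path E p (c # u @ w) r"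

lemma marked_path_append:
  assumes "marked_path E p u q" "marked_path E q v r"
  shows "marked_path E p (u @ v) r"
  using assms
proof (induction rule: marked_path.induct)
  case (marked_path_edge p c L q u w r')
  then show ?case using marked_path.marked_path_edge[of p c L q E u "w @ v" r] by simp
qed simp

lemma marked_path_single_edge:
  assumes "(p, c, L, q) \<in> E" "u \<in> L"
  shows "marked_path E p (c # u) q"
  using marked_path_edge[OF assms marked_path_Nil] by simp

text \<open>The idea behind the whole construction: regular combinations of counter languages do not need
  additional counters. Each edge gets its own copy of an automaton for its language. All copies use
  the same \<open>k\<close> counters, which they find equal to zero, and which they must return to zero, because
  the epsilon transition that leaves a copy tests this. The automaton is quasi-realtime because a
  chain of epsilon transitions can leave a copy, but must read a letter to enter the next one.\<close>

theorem marked_path_language_in_counter_languages: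
  fixes E :: "('v, 'a) marked_edge set"
  assumes E: "finite E" "\<And>p c L q. (p, c, L, q) \<in> E \<Longrightarrow> L \<in> counter_languages k"
  shows "{w. \<exists>q \<in> F. marked_path E s w q} \<in> counter_languages k"
proof -
  define aut :: "('v, 'a) marked_edge \<Rightarrow> (nat, 'a) counter_automaton" where
    "aut e = (SOME M. counter_automaton k M \<and> quasi_realtime M \<and>
       accepted_language k M = edge_language e)" for e
  have aut: "counter_automaton k (aut e)" "quasi_realtime (aut e)"
    "accepted_language k (aut e) = edge_language e" if "e \<in> E" for e
  proof -
    from E(2) that have "edge_language e \<in> counter_languages k"
      by (metis prod.collapse)
    then have "\<exists>M :: (nat, 'a) counter_automaton. counter_automaton k M \<and> quasi_realtime M \<and>
       accepted_language k M = edge_language e"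
      by (auto simp: counter_languages_def)
    then have "counter_automaton k (aut e) \<and> quasi_realtime (aut e) \<and>
      accepted_language k (aut e) = edge_language e"
      unfolding aut_def by (rule someI_ex)
    then show "counter_automaton k (aut e)" "quasi_realtime (aut e)"
      "accepted_language k (aut e) = edge_language e" by auto
  qed
  define V where "V = insert s (edge_source ` E \<union> edge_target ` E)"
  define enter :: "(('v + ('v, 'a) marked_edge \<times> nat) \<times> 'a option \<times> instr list \<times>
      ('v + ('v, 'a) marked_edge \<times> nat)) set"
    where "enter = (\<lambda>e. (Inl (edge_source e), Some (edge_letter e), [], Inr (e, start (aut e)))) ` E"
  define inner :: "(('v + ('v, 'a) marked_edge \<times> nat) \<times> 'a option \<times> instr list \<times>
      ('v + ('v, 'a) marked_edge \<times> nat)) set"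
    where "inner = (\<Union>e \<in> E. (\<lambda>(a, x, is, b). (Inr (e, a), x, is, Inr (e, b))) ` transitions (aut e))"
  define exit :: "(('v + ('v, 'a) marked_edge \<times> nat) \<times> 'a option \<times> instr list \<times>
      ('v + ('v, 'a) marked_edge \<times> nat)) set"
    where "exit = (\<Union>e \<in> E. (\<lambda>a. (Inr (e, a), None, map Test_zero [0..<k], Inl (edge_target e))) `
      accepting (aut e))"
  define M where "M = \<lparr>states = Inl ` V \<union> Inr ` (SIGMA e:E. states (aut e)), start = Inl s,
     accepting = Inl ` (F \<inter> V), transitions = enter \<union> inner \<union> exit\<rparr>"
  note defs = M_def enter_def inner_def exit_def
  have tr_Inl_Inl: "(Inl p, a, is, Inl q) \<notin> transitions M" for p a "is" q
    by (auto simp: defs)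
  have tr_Inl_Inr: "(Inl p, a, is, Inr (e, b)) \<in> transitions M \<longleftrightarrow>
      e \<in> E \<and> p = edge_source e \<and> a = Some (edge_letter e) \<and> is = [] \<and> b = start (aut e)"
    for p a "is" e b
    by (auto simp: defs image_iff)
  have tr_Inr_Inr: "(Inr (e, b), a, is, Inr (e', b')) \<in> transitions M \<longleftrightarrow>
      e' = e \<and> e \<in> E \<and> (b, a, is, b') \<in> transitions (aut e)" for a "is" e b e' b'
    by (auto simp: defs image_iff split: prod.splits)
  have tr_Inr_Inl: "(Inr (e, b), a, is, Inl q) \<in> transitions M \<longleftrightarrow>
      e \<in> E \<and> b \<in> accepting (aut e) \<and> a = None \<and> is = map Test_zero [0..<k] \<and> q = edge_target e"
    for a "is" e b q
    by (auto simp: defs image_iff split: prod.splits)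
  note tr = tr_Inl_Inl tr_Inl_Inr tr_Inr_Inr tr_Inr_Inl
  have st_Inl: "Inl p \<in> states M \<longleftrightarrow> p \<in> V" for p
    by (auto simp: M_def)
  have st_Inr: "Inr (e, b) \<in> states M \<longleftrightarrow> e \<in> E \<and> b \<in> states (aut e)" for e b
    by (auto simp: M_def)
  have M: "counter_automaton k M"
    unfolding counter_automaton_def
  proof (intro conjI ballI)
    have fin: "finite (states (aut e))" "finite (accepting (aut e))" "finite (transitions (aut e))"
      if "e \<in> E" for e
      using aut(1)[OF that] by (auto simp: counter_automaton_def intro: finite_subset)
    show "finite (states M)" "finite (transitions M)"
      using E(1) fin by (simp_all add: defs V_def)
    fix t assume t: "t \<in> transitions M"
    obtain x a "is" y where t_eq: "t = (x, a, is, y)" by (cases t)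
    have ends: "start (aut e) \<in> states (aut e)" "accepting (aut e) \<subseteq> states (aut e)"
      "\<And>b a is b'. (b, a, is, b') \<in> transitions (aut e) \<Longrightarrow>
         b \<in> states (aut e) \<and> b' \<in> states (aut e) \<and> (\<forall>i \<in> set is. counter_of i < k)"
      if "e \<in> E" for e
      using aut(1)[OF that] unfolding counter_automaton_def by blast+
    have V: "edge_source e \<in> V" "edge_target e \<in> V" if "e \<in> E" for e
      using that by (auto simp: V_def)
    have "x \<in> states M \<and> y \<in> states M \<and> (\<forall>i \<in> set is. counter_of i < k)"
    proof (cases x)
      case (Inl p)
      then obtain e b where y: "y = Inr (e, b)"
        using t by (cases y) (auto simp: t_eq tr)
      show ?thesis
        using t ends(1) V unfolding t_eq Inl y by (simp add: tr st_Inl st_Inr)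
    next
      case (Inr eb)
      then obtain e b where x: "x = Inr (e, b)" by (cases eb) simp
      show ?thesis
      proof (cases y)
        case y: (Inl q)
        show ?thesis
          using t ends(2)[of e] V[of e] unfolding t_eq x y by (auto simp: tr st_Inl st_Inr)
      next
        case (Inr eb')
        then obtain e' b' where y: "y = Inr (e', b')" by (cases eb') simp
        show ?thesis
          using t ends(3) unfolding t_eq x y by (simp add: tr st_Inr) blast
      qed
    qed
    then show "case t of (p, a, is, q) \<Rightarrow>
        p \<in> states M \<and> q \<in> states M \<and> (\<forall>i \<in> set is. counter_of i < k)"
      by (simp add: t_eq)
  qed (auto simp: M_def V_def)

  have step_node: "step M a (Inl p, c) cf \<longleftrightarrow>
      (\<exists>e \<in> E. p = edge_source e \<and> a = Some (edge_letter e) \<and> cf = (Inr (e, start (aut e)), c))"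
    for a p c cf
    by (cases cf; cases "fst cf") (auto simp: step_def tr)
  have step_inner: "step M x (Inr (e, a), c) (Inr (e', b), d) \<longleftrightarrow>
      e' = e \<and> e \<in> E \<and> step (aut e) x (a, c) (b, d)" for x e a c e' b d
    by (auto simp: step_def tr)
  have step_exit: "step M x (Inr (e, a), c) (Inl q, d) \<longleftrightarrow>
      e \<in> E \<and> x = None \<and> a \<in> accepting (aut e) \<and> q = edge_target e \<and> d = c \<and> (\<forall>i<k. c i = 0)"
    for x e a c q d
    by (auto simp: step_def tr exec_instrs_Test_zero)

  \<comment> \<open>An invariant of the reachable configurations: a node is reached along a path, with zero
    counters, and a state inside the copy for \<open>e\<close> by a path to \<open>e\<close> and a run of its automaton.\<close>
  define reached :: "'a list \<Rightarrow> ('v + ('v, 'a) marked_edge \<times> nat) \<times> counters \<Rightarrow> bool" where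
    "reached w cf \<longleftrightarrow> (case cf of
       (Inl q, c) \<Rightarrow> c = (\<lambda>_. 0) \<and> marked_path E s w q
     | (Inr (e, a), c) \<Rightarrow> e \<in> E \<and> (\<exists>v u. w = v @ edge_letter e # u \<and> marked_path E s v (edge_source e) \<and>
          run (aut e) (start_config (aut e)) u (a, c)))" for w cf
  have reached: "reached w cf" if "run M (start_config M) w cf" for w cf
  proof -
    have "reached ([] @ w) cf"
      using that
    proof (rule run_invariant)
      show "reached [] (start_config M)"
        by (simp add: reached_def start_config_def M_def marked_path_Nil)
    next
      fix v cf cf' assume *: "reached v cf" "step M None cf cf'"
      from *(2) obtain e a c where cf: "cf = (Inr (e, a), c)"
        by (cases cf; cases "fst cf") (auto simp: step_node)
      from *(1) obtain v' u where r: "e \<in> E" "v = v' @ edge_letter e # u" "marked_path E s v' (edge_source e)"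
          "run (aut e) (start_config (aut e)) u (a, c)"
        by (auto simp: cf reached_def)
      show "reached v cf'"
      proof (cases "fst cf'")
        case (Inl q)
        then have q: "a \<in> accepting (aut e)" "q = edge_target e" "snd cf' = c" "\<forall>i<k. c i = 0"
          using *(2) step_exit[of None e a c q "snd cf'"] by (cases cf'; simp add: cf)+
        have c: "c = (\<lambda>_. 0)"
        proof
          fix i show "c i = 0"
            using q(4) run_unused_counter[OF r(4) aut(1)[OF r(1)], of i]
            by (cases "i < k") (auto simp: start_config_def)
        qed
        have "u \<in> edge_language e"
          using r(4) q(1) unfolding aut(3)[OF r(1), symmetric] c
          by (auto simp: accepted_language_def)
        then have "marked_path E (edge_source e) (edge_letter e # u) q"
          using r(1) q(2) by (intro marked_path_single_edge) auto
        with r(2,3) have "marked_path E s v q" by (auto intro: marked_path_append)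
        then show ?thesis using q(3) c Inl by (cases cf') (simp add: reached_def)
      next
        case (Inr eb)
        with *(2) obtain b where b: "cf' = (Inr (e, b), snd cf')"
            "step (aut e) None (a, c) (b, snd cf')"
          by (cases cf'; cases eb) (auto simp: cf step_inner)
        have "run (aut e) (start_config (aut e)) u (b, snd cf')"
          using run_append[OF r(4) run_single_epsilon[OF b(2)]] by simp
        then have "reached v (Inr (e, b), snd cf')"
          using r(1-3) by (auto simp: reached_def)
        with b(1) show ?thesis by simp
      qed
    next
      fix v x cf cf' assume *: "reached v cf" "step M (Some x) cf cf'"
      show "reached (v @ [x]) cf'"
      proof (cases "fst cf")
        case (Inl p)
        with *(1) have r: "snd cf = (\<lambda>_. 0)" "marked_path E s v p"
          by (auto simp: reached_def split: prod.splits)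
        from *(2) Inl obtain e where e: "e \<in> E" "p = edge_source e" "x = edge_letter e"
            "cf' = (Inr (e, start (aut e)), snd cf)"
          using step_node[of "Some x" p "snd cf" cf'] by (cases cf) auto
        have "run (aut e) (start_config (aut e)) [] (start (aut e), snd cf)"
          using r(1) by (simp add: start_config_def run.run_refl)
        then show ?thesis
          using e r(2) by (auto simp: reached_def)
      next
        case (Inr ea)
        then obtain e a c where cf: "cf = (Inr (e, a), c)"
          by (cases cf; cases ea) auto
        from *(1) obtain v' u where r: "e \<in> E" "v = v' @ edge_letter e # u" "marked_path E s v' (edge_source e)"
            "run (aut e) (start_config (aut e)) u (a, c)"
          by (auto simp: cf reached_def)
        from *(2) obtain b where b: "cf' = (Inr (e, b), snd cf')" "step (aut e) (Some x) (a, c) (b, snd cf')"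
          by (cases cf'; cases "fst cf'") (auto simp: cf step_inner step_exit)
        have "run (aut e) (start_config (aut e)) (u @ [x]) (b, snd cf')"
          using run_append[OF r(4) run_single_letter[OF b(2)]] by simp
        then have "reached (v @ [x]) (Inr (e, b), snd cf')"
          using r(1-3) by (auto simp: reached_def)
        with b(1) show ?thesis by simp
      qed
    qed
    then show ?thesis by simp
  qed

  have inner_run: "run M (Inr (e, a), c) u (Inr (e, b), d)"
    if "run (aut e) (a, c) u (b, d)" "e \<in> E" for e a c u b d
    using that
  proof (induction "(a, c)" u "(b, d)" arbitrary: a c rule: run.induct)
    case run_refl
    then show ?case by (simp add: run.run_refl)
  next
    case (run_epsilon cf w)
    obtain a' c' where cf: "cf = (a', c')" by force
    have "step M None (Inr (e, a), c) (Inr (e, a'), c')"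
      using run_epsilon cf by (simp add: step_inner)
    moreover have "run M (Inr (e, a'), c') w (Inr (e, b), d)"
      using run_epsilon cf by blast
    ultimately show ?case by (rule run.run_epsilon)
  next
    case (run_letter x cf w)
    obtain a' c' where cf: "cf = (a', c')" by force
    have "step M (Some x) (Inr (e, a), c) (Inr (e, a'), c')"
      using run_letter cf by (simp add: step_inner)
    moreover have "run M (Inr (e, a'), c') w (Inr (e, b), d)"
      using run_letter cf by blast
    ultimately show ?case by (rule run.run_letter)
  qed
  have path_run: "run M (Inl p, \<lambda>_. 0) w (Inl q, \<lambda>_. 0)" if "marked_path E p w q" for p w q
    using that
  proof (induction rule: marked_path.induct)
    case (marked_path_Nil p)
    then show ?case by (rule run.run_refl)
  next
    case (marked_path_edge p x L q u w r)
    let ?e = "(p, x, L, q)"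
    have "u \<in> accepted_language k (aut ?e)"
      using marked_path_edge.hyps aut(3) by simp
    then obtain a where a: "a \<in> accepting (aut ?e)"
        "run (aut ?e) (start_config (aut ?e)) u (a, \<lambda>_. 0)"
      unfolding accepted_language_zero_counters[OF aut(1)[OF marked_path_edge.hyps(1)]] by blast
    have "run M (Inl p, \<lambda>_. 0) [x] (Inr (?e, start (aut ?e)), \<lambda>_. 0)"
      using marked_path_edge.hyps(1) by (intro run_single_letter) (force simp: step_node)
    moreover have "run M (Inr (?e, start (aut ?e)), \<lambda>_. 0) u (Inr (?e, a), \<lambda>_. 0)"
      using a(2) marked_path_edge.hyps(1) by (intro inner_run) (simp_all add: start_config_def)
    moreover have "run M (Inr (?e, a), \<lambda>_. 0) [] (Inl q, \<lambda>_. 0)"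
      using a(1) marked_path_edge.hyps(1) by (intro run_single_epsilon) (auto simp: step_exit)
    ultimately have "run M (Inl p, \<lambda>_. 0) ([x] @ u @ [] @ w) (Inl r, \<lambda>_. 0)"
      using marked_path_edge.IH by (blast intro: run_append)
    then show ?case by simp
  qed

  have path_V: "q \<in> V" if "marked_path E p w q" "p \<in> V" for p w q
    using that
  proof (induction rule: marked_path.induct)
    case (marked_path_edge p x L q u w r)
    have "q \<in> edge_target ` E"
      using marked_path_edge.hyps(1) by (rule rev_image_eqI) simp
    then show ?case using marked_path_edge.IH by (simp add: V_def)
  qed
  have "accepted_language k M = {w. \<exists>q \<in> F. marked_path E s w q}"
    unfolding accepted_language_zero_counters[OF M]
  proof (intro equalityI subsetI)
    fix w assume "w \<in> {w. \<exists>q\<in>accepting M. run M (start_config M) w (q, \<lambda>_. 0)}"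
    then show "w \<in> {w. \<exists>q \<in> F. marked_path E s w q}"
      using reached[of w] by (fastforce simp: M_def reached_def)
  next
    fix w assume "w \<in> {w. \<exists>q \<in> F. marked_path E s w q}"
    then obtain q where q: "q \<in> F" "marked_path E s w q" by blast
    moreover have "q \<in> V" using path_V[OF q(2)] by (simp add: V_def)
    moreover have "run M (start_config M) w (Inl q, \<lambda>_. 0)"
      using path_run[OF q(2)] by (simp add: start_config_def M_def)
    ultimately show "w \<in> {w. \<exists>q\<in>accepting M. run M (start_config M) w (q, \<lambda>_. 0)}"
      by (auto simp: M_def)
  qed
  moreover have "quasi_realtime M"
  proof -
    have "\<forall>e \<in> E. \<exists>B. \<forall>w cf cf' n. run (aut e) (start_config (aut e)) w cf \<longrightarrow>
        (step (aut e) None ^^ n) cf cf' \<longrightarrow> n \<le> B"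
      using aut(2) unfolding quasi_realtime_def by blast
    then obtain B where B: "\<And>e w cf cf' n. e \<in> E \<Longrightarrow> run (aut e) (start_config (aut e)) w cf \<Longrightarrow>
        (step (aut e) None ^^ n) cf cf' \<Longrightarrow> n \<le> B e"
      by metis
    \<comment> \<open>Nothing but the last step of a chain of epsilon steps can leave the copy for \<open>e\<close>.\<close>
    have steps: "\<exists>m a' c'. n \<le> Suc m \<and> (step (aut e) None ^^ m) (a, c) (a', c') \<and>
        (cf' = (Inr (e, a'), c') \<and> n = m \<or> (\<exists>q. fst cf' = Inl q))"
      if "(step M None ^^ n) (Inr (e, a), c) cf'" for n e a c cf'
      using that
    proof (induction n arbitrary: cf')
      case (Suc n)
      then obtain cf1 where cf1: "(step M None ^^ n) (Inr (e, a), c) cf1" "step M None cf1 cf'"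
        by auto
      from cf1(2) have "\<nexists>q. fst cf1 = Inl q"
        by (cases cf1) (auto simp: step_node)
      with Suc.IH[OF cf1(1)] obtain a' c' where a': "(step (aut e) None ^^ n) (a, c) (a', c')"
          "cf1 = (Inr (e, a'), c')"
        by blast
      show ?case
      proof (cases "fst cf'")
        case (Inl q)
        with a' show ?thesis by auto
      next
        case (Inr eb)
        then obtain b d where "cf' = (Inr (e, b), d)" "step (aut e) None (a', c') (b, d)"
          using cf1(2) a'(2) by (cases cf'; cases eb) (auto simp: step_inner)
        with a'(1) show ?thesis
          by (intro exI[of _ "Suc n"] exI[of _ b] exI[of _ d]) (simp add: relcomppI)
      qed
    qed auto
    have "n \<le> Suc (Max (insert 0 (B ` E)))"
      if run: "run M (start_config M) w cf" and eps: "(step M None ^^ n) cf cf'" for w cf cf' n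
    proof (cases "fst cf")
      case (Inl p)
      then have "\<not> step M None cf cf1" for cf1
        by (cases cf) (simp add: step_node)
      then have "n = 0"
        using eps by (cases n) (blast elim: relpowp_Suc_E2)+
      then show ?thesis by simp
    next
      case (Inr ea)
      then obtain e a c where cf: "cf = (Inr (e, a), c)"
        by (cases cf; cases ea) auto
      with reached[OF run] obtain u where u: "e \<in> E" "run (aut e) (start_config (aut e)) u (a, c)"
        by (auto simp: reached_def)
      obtain m cf1 where "n \<le> Suc m" "(step (aut e) None ^^ m) (a, c) cf1"
        using steps eps cf by metis
      with B[OF u] have "n \<le> Suc (B e)" by fastforce
      moreover have "B e \<le> Max (insert 0 (B ` E))"
        using u(1) E(1) by (intro Max_ge) auto
      ultimately show ?thesis by simp
    qed
    then show ?thesis unfolding quasi_realtime_def by blast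
  qed
  ultimately show ?thesis
    using accepted_language_in_counter_languages[OF M] by simp
qed

lemma singleton_in_counter_languages: "{w} \<in> counter_languages k"
proof (induction w)
  case Nil
  then show ?case by (rule Nil_language_in_counter_languages)
next
  case (Cons a w)
  define E where "E = {(False, a, {w}, True)}"
  have "marked_path E True v q \<longleftrightarrow> v = [] \<and> q" for v q
    by (subst marked_path.simps) (auto simp: E_def)
  then have "marked_path E False v True \<longleftrightarrow> v = a # w" for v
    by (subst marked_path.simps) (auto simp: E_def)
  then have "{v. \<exists>q \<in> {True}. marked_path E False v q} = {a # w}"
    by blast
  moreover have "{v. \<exists>q \<in> {True}. marked_path E False v q} \<in> counter_languages k"
    using Cons by (intro marked_path_language_in_counter_languages) (auto simp: E_def)
  ultimately show ?case by (simp only:)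
qed

text \<open>Concatenation of a path language with a language of words starting with a marker: the edges in
  \<open>T\<close> are attached to all final nodes and lead to a new sink.\<close>

lemma marked_path_last_edge_in_counter_languages:
  fixes E :: "('v, 'a) marked_edge set"
  assumes E: "finite E" "\<And>p c L q. (p, c, L, q) \<in> E \<Longrightarrow> L \<in> counter_languages k"
    and T: "finite T" "\<And>c L. (c, L) \<in> T \<Longrightarrow> L \<in> counter_languages k"
    and F: "finite F"
  shows "{w @ c # u | w c L u. (\<exists>q \<in> F. marked_path E s w q) \<and> (c, L) \<in> T \<and> u \<in> L}
     \<in> counter_languages k" (is "?A \<in> _")
proof -
  define E' where "E' = (\<lambda>(p, c, L, q). (Some p, c, L, Some q)) ` E \<union>
     (\<lambda>(p, c, L). (Some p, c, L, None)) ` (F \<times> T)"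
  have stuck: "v = [] \<and> q = None" if "marked_path E' None v q" for v q
    using that by (cases rule: marked_path.cases) (auto simp: E'_def)
  have emb: "marked_path E' (Some p) w (Some q)" if "marked_path E p w q" for p w q
    using that
  proof (induction rule: marked_path.induct)
    case (marked_path_edge p c L q u w r)
    then have "(Some p, c, L, Some q) \<in> E'" by (force simp: E'_def)
    then show ?case
      using marked_path_edge.hyps(2) marked_path_edge.IH by (rule marked_path.marked_path_edge)
  qed (rule marked_path.marked_path_Nil)
  have split: "\<exists>v c L u. w = v @ c # u \<and> (\<exists>q \<in> F. marked_path E p v q) \<and> (c, L) \<in> T \<and> u \<in> L"
    if "marked_path E' (Some p) w None" for p w
    using that
  proof (induction "Some p" w "None :: 'v option" arbitrary: p rule: marked_path.induct)
    case (marked_path_edge c L q u w)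
    show ?case
    proof (cases q)
      case None
      with marked_path_edge stuck have "w = []" by blast
      with marked_path_edge None have "p \<in> F" "(c, L) \<in> T"
        by (auto simp: E'_def)
      with marked_path_edge \<open>w = []\<close> show ?thesis
        by (intro exI[of _ "[]"]) (auto intro: marked_path_Nil)
    next
      case (Some q')
      with marked_path_edge have e: "(p, c, L, q') \<in> E" by (auto simp: E'_def)
      from Some marked_path_edge obtain v d L' u' r where
        "w = v @ d # u'" "r \<in> F" "marked_path E q' v r" "(d, L') \<in> T" "u' \<in> L'" by blast
      moreover from this have "marked_path E p (c # u @ v) r"
        using marked_path.marked_path_edge[OF e] marked_path_edge by blast
      ultimately show ?thesis
        by (intro exI[of _ "c # u @ v"] exI[of _ d] exI[of _ L'] exI[of _ u']) auto
    qed
  qed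
  have "{w. \<exists>q \<in> {None}. marked_path E' (Some s) w q} = ?A"
  proof (intro equalityI subsetI)
    fix w assume "w \<in> {w. \<exists>q \<in> {None}. marked_path E' (Some s) w q}"
    then show "w \<in> ?A" using split[of s w] by blast
  next
    fix w assume "w \<in> ?A"
    then obtain v c L u q where w: "w = v @ c # u" "q \<in> F" "marked_path E s v q" "(c, L) \<in> T" "u \<in> L"
      by blast
    then have "(Some q, c, L, None) \<in> E'" by (force simp: E'_def)
    then have "marked_path E' (Some q) (c # u) None"
      using w(5) by (rule marked_path_single_edge)
    with emb[OF w(3)] w(1) show "w \<in> {w. \<exists>q \<in> {None}. marked_path E' (Some s) w q}"
      by (auto intro: marked_path_append)
  qed
  moreover have "{w. \<exists>q \<in> {None}. marked_path E' (Some s) w q} \<in> counter_languages k"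
    using E T F by (intro marked_path_language_in_counter_languages) (auto simp: E'_def)
  ultimately show ?thesis by simp
qed

lemma marked_path_image:
  "marked_path ((\<lambda>(p, c, L, q). (p, f c, map f ` L, q)) ` E) p w q \<longleftrightarrow>
     (\<exists>v. w = map f v \<and> marked_path E p v q)" (is "marked_path ?E p w q \<longleftrightarrow> _")
proof
  assume "marked_path ?E p w q"
  then show "\<exists>v. w = map f v \<and> marked_path E p v q"
  proof (induction rule: marked_path.induct)
    case (marked_path_Nil p)
    then show ?case by (auto intro: marked_path.intros)
  next
    case (marked_path_edge p c L q u w r)
    then obtain c' L' u' v where "(p, c', L', q) \<in> E" "c = f c'" "u' \<in> L'" "u = map f u'"
        "w = map f v" "marked_path E q v r" by auto
    then show ?case
      by (intro exI[of _ "c' # u' @ v"]) (auto intro: marked_path.intros)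
  qed
next
  assume "\<exists>v. w = map f v \<and> marked_path E p v q"
  then obtain v where "marked_path E p v q" and w: "w = map f v" by blast
  from this(1) have "marked_path ?E p (map f v) q"
  proof (induction rule: marked_path.induct)
    case (marked_path_Nil p)
    then show ?case by (auto intro: marked_path.intros)
  next
    case (marked_path_edge p c L q u w r)
    have "(p, f c, map f ` L, q) \<in> ?E" "map f u \<in> map f ` L"
      using marked_path_edge.hyps by force+
    from marked_path.marked_path_edge[OF this marked_path_edge.IH] show ?case by simp
  qed
  with w show "marked_path ?E p w q" by simp
qed

section \<open>Convolutions and renaming of alphabets\<close>

lemma convolution_simps [simp]:
  "convolution [] [] = []"
  "convolution (a # u) [] = (Some a, None) # convolution u []"
  "convolution [] (b # v) = (None, Some b) # convolution [] v"
  "convolution (a # u) (b # v) = (Some a, Some b) # convolution u v"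
  by (simp_all add: convolution_def map_upt_Suc del: upt_Suc)

lemma convolution_Nil:
  "convolution u [] = map (\<lambda>a. (Some a, None)) u" "convolution [] v = map (\<lambda>b. (None, Some b)) v"
  by (induction u, simp_all) (induction v, simp_all)

text \<open>A common prefix aligns the remainders, so that the automata for the factors can be run on the
  convolution of the last syllables.\<close>

lemma convolution_common_prefix:
  "convolution (p @ u) (p @ v) = map (\<lambda>a. (Some a, Some a)) p @ convolution u v"
  by (induction p) auto

lemma convolution_map:
  "convolution (map f u) (map f v) = map (map_prod (map_option f) (map_option f)) (convolution u v)"
  by (induction u v rule: list_induct2') (auto simp: convolution_Nil)

lemma map_filter_convolution:
  "List.map_filter fst (convolution u v) = u" "List.map_filter snd (convolution u v) = v"
  by (induction u v rule: list_induct2') (auto simp: convolution_Nil List.map_filter_def filter_map comp_def)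

text \<open>Injectivity of the convolution makes it possible to delete single pairs from a multiplication
  language by deleting words.\<close>

lemma convolution_eq_iff: "convolution u v = convolution u' v' \<longleftrightarrow> u = u' \<and> v = v'"
  by (metis map_filter_convolution)

lemma counter_graph_automatic_rename:
  assumes aut: "counter_graph_automatic k G X \<Lambda>" and f: "inj_on f \<Lambda>"
  shows "counter_graph_automatic k G X (f ` \<Lambda>)"
proof -
  obtain L \<phi> where L: "L \<subseteq> lists \<Lambda>" "bij_betw \<phi> L (carrier G)" "L \<in> counter_languages k"
    and Lx: "\<And>x. x \<in> X \<Longrightarrow>
      {convolution u v | u v. u \<in> L \<and> v \<in> L \<and> \<phi> v = \<phi> u \<otimes>\<^bsub>G\<^esub> x} \<in> counter_languages k"
    using aut unfolding counter_graph_automatic_def normal_form_def by blast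
  have inj: "inj_on (map f) L"
    using f L(1) by (blast intro: inj_on_subset inj_on_map_lists)
  define \<psi> where "\<psi> = \<phi> \<circ> inv_into L (map f)"
  have \<psi>: "\<psi> (map f u) = \<phi> u" if "u \<in> L" for u
    using inj that by (simp add: \<psi>_def)
  have "bij_betw \<psi> (map f ` L) (carrier G)"
    unfolding \<psi>_def
    using bij_betw_trans[OF bij_betw_inv_into[OF inj_on_imp_bij_betw[OF inj]] L(2)] .
  moreover have "map f ` L \<subseteq> lists (f ` \<Lambda>)"
    using L(1) by (fastforce simp: in_lists_conv_set)
  moreover have "map f ` L \<in> counter_languages k"
    using L(3) by (rule counter_languages_image)
  moreover have "{convolution u v | u v. u \<in> map f ` L \<and> v \<in> map f ` L \<and> \<psi> v = \<psi> u \<otimes>\<^bsub>G\<^esub> x}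
      \<in> counter_languages k" if "x \<in> X" for x
  proof -
    have "{convolution u v | u v. u \<in> map f ` L \<and> v \<in> map f ` L \<and> \<psi> v = \<psi> u \<otimes>\<^bsub>G\<^esub> x} =
      map (map_prod (map_option f) (map_option f)) `
        {convolution u v | u v. u \<in> L \<and> v \<in> L \<and> \<phi> v = \<phi> u \<otimes>\<^bsub>G\<^esub> x}"
      by (auto simp: \<psi> image_iff) (metis convolution_map \<psi>)+
    then show ?thesis using counter_languages_image[OF Lx[OF that]] by simp
  qed
  ultimately show ?thesis
    unfolding counter_graph_automatic_def normal_form_def by blast
qed

text \<open>The letters 0 and 1 are kept free; they will mark the beginnings of syllables.\<close>

lemma counter_graph_automatic_nat_alphabet:
  assumes "finite \<Lambda>" "counter_graph_automatic k G X \<Lambda>" "k \<le> K"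
  obtains \<Lambda>' :: "nat set" and L \<phi> where "finite \<Lambda>'" "\<Lambda>' \<subseteq> {2..}" "L \<subseteq> lists \<Lambda>'"
    "bij_betw \<phi> L (carrier G)" "L \<in> counter_languages K"
    "\<And>x. x \<in> X \<Longrightarrow> {convolution u v | u v. u \<in> L \<and> v \<in> L \<and> \<phi> v = \<phi> u \<otimes>\<^bsub>G\<^esub> x} \<in> counter_languages K"
proof -
  obtain f :: "'a \<Rightarrow> nat" where f: "inj_on f \<Lambda>"
    using finite_imp_inj_to_nat_seg[OF assms(1)] by blast
  define \<Lambda>' where "\<Lambda>' = (\<lambda>a. f a + 2) ` \<Lambda>"
  have "inj_on (\<lambda>a. f a + 2) \<Lambda>"
    using f by (simp add: inj_on_def)
  then have "counter_graph_automatic k G X \<Lambda>'"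
    unfolding \<Lambda>'_def by (rule counter_graph_automatic_rename[OF assms(2)])
  then obtain L \<phi> where L: "L \<subseteq> lists \<Lambda>'" "bij_betw \<phi> L (carrier G)" "L \<in> counter_languages k"
      "\<And>x. x \<in> X \<Longrightarrow> {convolution u v | u v. u \<in> L \<and> v \<in> L \<and> \<phi> v = \<phi> u \<otimes>\<^bsub>G\<^esub> x} \<in> counter_languages k"
    unfolding counter_graph_automatic_def normal_form_def by blast
  show thesis
  proof (rule that[OF _ _ L(1,2)])
    show "finite \<Lambda>'" using assms(1) by (simp add: \<Lambda>'_def)
    show "\<Lambda>' \<subseteq> {2..}" by (auto simp: \<Lambda>'_def)
    show "L \<in> counter_languages K"
      using L(3) counter_languages_mono[OF assms(3)] by blast
    show "{convolution u v | u v. u \<in> L \<and> v \<in> L \<and> \<phi> v = \<phi> u \<otimes>\<^bsub>G\<^esub> x} \<in> counter_languages K"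
      if "x \<in> X" for x
      using L(4)[OF that] counter_languages_mono[OF assms(3)] by (rule subsetD[rotated])
  qed
qed

section \<open>Right multiplication of reduced words\<close>

text \<open>No cancellation happens at a boundary inside a reduced word. In particular a product
  \<open>p \<cdot> t\<close> of this kind leaves the prefix \<open>p\<close> intact.\<close>

lemma free_product_append:
  assumes "group G" "group H" "p @ t \<in> reduced_words G H"
  shows "foldr (syllable_mult G H) p t = p @ t"
proof -
  have "t \<in> reduced_words G H"
    using assms(3) by (auto simp: reduced_words_def successively_append_iff)
  then have "foldr (syllable_mult G H) p t = foldr (syllable_mult G H) (p @ t) []"
    by (simp add: foldr_syllable_mult_Nil)
  also have "\<dots> = p @ t"
    using assms(3) by (rule foldr_syllable_mult_Nil)
  finally show ?thesis .
qed

lemma reduced_words_snoc: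
  "p @ [s] \<in> reduced_words G H \<longleftrightarrow>
     syllable G H s \<and> p \<in> reduced_words G H \<and> (p = [] \<or> isl (last p) \<noteq> isl s)"
  by (auto simp: reduced_words_def successively_append_iff)

text \<open>Seen from one factor, a reduced word is a prefix that does not end in this factor, followed by at
  most one syllable of this factor. Right multiplication by an element of the factor keeps the
  prefix.\<close>

lemma reduced_words_split_last:
  shows "reduced_words G H = {p \<in> reduced_words G H. p = [] \<or> \<not> isl (last p)} \<union>
      {p @ [Inl g] | p g. p \<in> {p \<in> reduced_words G H. p = [] \<or> \<not> isl (last p)} \<and>
         g \<in> carrier G \<and> g \<noteq> \<one>\<^bsub>G\<^esub>}" (is "_ = ?P \<union> ?Q")
    and "reduced_words G H = {p \<in> reduced_words G H. p = [] \<or> isl (last p)} \<union>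
      {p @ [Inr h] | p h. p \<in> {p \<in> reduced_words G H. p = [] \<or> isl (last p)} \<and>
         h \<in> carrier H \<and> h \<noteq> \<one>\<^bsub>H\<^esub>}" (is "_ = ?P' \<union> ?Q'")
proof -
  have "w \<in> ?P \<union> ?Q \<and> w \<in> ?P' \<union> ?Q'" if "w \<in> reduced_words G H" for w
  proof (cases w rule: rev_cases)
    case (snoc p s)
    with that show ?thesis by (cases s) (auto simp: reduced_words_snoc)
  qed simp
  moreover have "?Q \<subseteq> reduced_words G H" "?Q' \<subseteq> reduced_words G H"
    by (auto simp: reduced_words_snoc reduced_words_Cons)
  ultimately show "reduced_words G H = ?P \<union> ?Q" "reduced_words G H = ?P' \<union> ?Q'"
    by blast+
qed

lemma free_product_mult_snoc_Inl:
  assumes "group G" "group H" "p \<in> reduced_words G H" "p = [] \<or> \<not> isl (last p)"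
    and "x \<in> carrier G" "x \<noteq> \<one>\<^bsub>G\<^esub>"
  shows "p \<otimes>\<^bsub>free_product G H\<^esub> [Inl x] = p @ [Inl x]"
    and "g \<in> carrier G \<Longrightarrow> (p @ [Inl g]) \<otimes>\<^bsub>free_product G H\<^esub> [Inl x] =
      (if g \<otimes>\<^bsub>G\<^esub> x = \<one>\<^bsub>G\<^esub> then p else p @ [Inl (g \<otimes>\<^bsub>G\<^esub> x)])"
proof -
  interpret G: group G by fact
  have snoc: "foldr (syllable_mult G H) p [Inl a] = p @ [Inl a]" if "a \<in> carrier G" "a \<noteq> \<one>\<^bsub>G\<^esub>" for a
    using assms that by (intro free_product_append) (auto simp: reduced_words_snoc)
  with assms show "p \<otimes>\<^bsub>free_product G H\<^esub> [Inl x] = p @ [Inl x]"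
    by (simp add: free_product_def)
  show "(p @ [Inl g]) \<otimes>\<^bsub>free_product G H\<^esub> [Inl x] =
      (if g \<otimes>\<^bsub>G\<^esub> x = \<one>\<^bsub>G\<^esub> then p else p @ [Inl (g \<otimes>\<^bsub>G\<^esub> x)])" if "g \<in> carrier G"
    using snoc that assms by (simp add: free_product_def foldr_syllable_mult_Nil)
qed

lemma free_product_mult_snoc_Inr:
  assumes "group G" "group H" "p \<in> reduced_words G H" "p = [] \<or> isl (last p)"
    and "x \<in> carrier H" "x \<noteq> \<one>\<^bsub>H\<^esub>"
  shows "p \<otimes>\<^bsub>free_product G H\<^esub> [Inr x] = p @ [Inr x]"
    and "h \<in> carrier H \<Longrightarrow> (p @ [Inr h]) \<otimes>\<^bsub>free_product G H\<^esub> [Inr x] =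
      (if h \<otimes>\<^bsub>H\<^esub> x = \<one>\<^bsub>H\<^esub> then p else p @ [Inr (h \<otimes>\<^bsub>H\<^esub> x)])"
proof -
  interpret H: group H by fact
  have snoc: "foldr (syllable_mult G H) p [Inr a] = p @ [Inr a]" if "a \<in> carrier H" "a \<noteq> \<one>\<^bsub>H\<^esub>" for a
    using assms that by (intro free_product_append) (auto simp: reduced_words_snoc)
  with assms show "p \<otimes>\<^bsub>free_product G H\<^esub> [Inr x] = p @ [Inr x]"
    by (simp add: free_product_def)
  show "(p @ [Inr h]) \<otimes>\<^bsub>free_product G H\<^esub> [Inr x] =
      (if h \<otimes>\<^bsub>H\<^esub> x = \<one>\<^bsub>H\<^esub> then p else p @ [Inr (h \<otimes>\<^bsub>H\<^esub> x)])" if "h \<in> carrier H"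
    using snoc that assms by (simp add: free_product_def foldr_syllable_mult_Nil)
qed

section \<open>Generators of the free product\<close>

text \<open>The embedding of a factor into the free product, which sends the identity to the empty word. It
  is applied with \<open>Inl\<close> and \<open>Inr\<close> as \<open>\<iota>\<close>.\<close>

definition syllable_word :: "('g, 'm) monoid_scheme \<Rightarrow> ('g \<Rightarrow> 's) \<Rightarrow> 'g \<Rightarrow> 's list" where
  "syllable_word K \<iota> g = (if g = \<one>\<^bsub>K\<^esub> then [] else [\<iota> g])"

lemma syllable_word_Inl_hom:
  assumes "group G" "group H"
  shows "syllable_word G Inl \<in> hom G (free_product G H)"
proof -
  interpret G: group G by fact
  show ?thesis
    by (auto simp: hom_def syllable_word_def free_product_def reduced_words_Cons)
qed

lemma syllable_word_Inr_hom:
  assumes "group G" "group H"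
  shows "syllable_word H Inr \<in> hom H (free_product G H)"
proof -
  interpret H: group H by fact
  show ?thesis
    by (auto simp: hom_def syllable_word_def free_product_def reduced_words_Cons)
qed

text \<open>The image of a generating set under a homomorphism generates the image of the group, and leaving
  out the identity does no harm.\<close>

lemma generate_syllable_word:
  assumes "group K" "group P" and hom: "syllable_word K \<iota> \<in> hom K P"
    and X: "X \<subseteq> carrier K" "generate K X = carrier K"
    and one: "\<one>\<^bsub>P\<^esub> = []" and g: "g \<in> carrier K"
    and Z: "\<And>x. x \<in> X \<Longrightarrow> x \<noteq> \<one>\<^bsub>K\<^esub> \<Longrightarrow> [\<iota> x] \<in> Z" "Z \<subseteq> carrier P"
  shows "syllable_word K \<iota> g \<in> generate P Z"
proof -
  interpret P: group P by fact
  interpret h: group_hom K P "syllable_word K \<iota>"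
    by (intro group_hom.intro group_hom_axioms.intro assms)
  have "syllable_word K \<iota> g \<in> syllable_word K \<iota> ` generate K X"
    using g X(2) by blast
  then have "syllable_word K \<iota> g \<in> generate P (syllable_word K \<iota> ` X)"
    using h.generate_img[OF X(1)] by simp
  moreover have "syllable_word K \<iota> ` X \<subseteq> generate P Z"
    using Z(1) generate.one[of P Z] by (auto simp: syllable_word_def one intro: generate.incl)
  ultimately show ?thesis
    using P.generate_subgroup_incl P.generate_is_subgroup[OF Z(2)] by blast
qed

text \<open>The identity is left out because one-syllable words of identity elements are not reduced.\<close>

definition free_product_generators ::
  "('g, 'm) monoid_scheme \<Rightarrow> ('h, 'n) monoid_scheme \<Rightarrow> 'g set \<Rightarrow> 'h set \<Rightarrow> ('g + 'h) list set" where
  "free_product_generators G H X Y =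
     (\<lambda>x. [Inl x]) ` (X - {\<one>\<^bsub>G\<^esub>}) \<union> (\<lambda>y. [Inr y]) ` (Y - {\<one>\<^bsub>H\<^esub>})"

lemma symmetric_free_product_generators:
  assumes "group G" "group H" "symmetric_generating_set G X" "symmetric_generating_set H Y"
  shows "symmetric_generating_set (free_product G H) (free_product_generators G H X Y)"
    (is "symmetric_generating_set ?P ?Z")
proof -
  interpret G: group G by fact
  interpret H: group H by fact
  interpret P: group ?P using assms(1,2) by (rule group_free_product)
  have X: "X \<subseteq> carrier G" "\<And>x. x \<in> X \<Longrightarrow> inv\<^bsub>G\<^esub> x \<in> X" "generate G X = carrier G"
    and Y: "Y \<subseteq> carrier H" "\<And>x. x \<in> Y \<Longrightarrow> inv\<^bsub>H\<^esub> x \<in> Y" "generate H Y = carrier H"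
    using assms(3,4) by (auto simp: symmetric_generating_set_def)
  have carrier: "carrier ?P = reduced_words G H" and one: "\<one>\<^bsub>?P\<^esub> = []"
    by (simp_all add: free_product_def)
  have Z: "?Z \<subseteq> carrier ?P"
    using X(1) Y(1) by (auto simp: free_product_generators_def carrier reduced_words_Cons)
  have inv_Inl: "inv\<^bsub>?P\<^esub> [Inl g] = [Inl (inv\<^bsub>G\<^esub> g)]" if "g \<in> carrier G" "g \<noteq> \<one>\<^bsub>G\<^esub>" for g
    by (rule P.inv_equality) (use that in \<open>auto simp: free_product_def reduced_words_Cons\<close>)
  have inv_Inr: "inv\<^bsub>?P\<^esub> [Inr h] = [Inr (inv\<^bsub>H\<^esub> h)]" if "h \<in> carrier H" "h \<noteq> \<one>\<^bsub>H\<^esub>" for h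
    by (rule P.inv_equality) (use that in \<open>auto simp: free_product_def reduced_words_Cons\<close>)
  have "inv\<^bsub>?P\<^esub> z \<in> ?Z" if "z \<in> ?Z" for z
  proof -
    from that consider x where "z = [Inl x]" "x \<in> X" "x \<noteq> \<one>\<^bsub>G\<^esub>"
      | y where "z = [Inr y]" "y \<in> Y" "y \<noteq> \<one>\<^bsub>H\<^esub>"
      unfolding free_product_generators_def by blast
    then show ?thesis
    proof cases
      case 1
      with X(1) have "x \<in> carrier G" by blast
      with 1 X(2)[of x] show ?thesis by (auto simp: inv_Inl free_product_generators_def)
    next
      case 2
      with Y(1) have "y \<in> carrier H" by blast
      with 2 Y(2)[of y] show ?thesis by (auto simp: inv_Inr free_product_generators_def)
    qed
  qed
  moreover have "w \<in> generate ?P ?Z" if "w \<in> reduced_words G H" for w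
    using that
  proof (induction w)
    case Nil
    then show ?case using generate.one[of ?P ?Z] by (simp add: one)
  next
    case (Cons s w)
    have "[s] \<in> generate ?P ?Z"
    proof (cases s)
      case (Inl g)
      with Cons.prems have "g \<in> carrier G" "g \<noteq> \<one>\<^bsub>G\<^esub>" by (auto simp: reduced_words_Cons)
      then show ?thesis
        using generate_syllable_word[OF assms(1) P.group_axioms syllable_word_Inl_hom[OF assms(1,2)]
            X(1,3) one _ _ Z, of g] Inl
        by (auto simp: syllable_word_def free_product_generators_def)
    next
      case (Inr g)
      with Cons.prems have "g \<in> carrier H" "g \<noteq> \<one>\<^bsub>H\<^esub>" by (auto simp: reduced_words_Cons)
      then show ?thesis
        using generate_syllable_word[OF assms(2) P.group_axioms syllable_word_Inr_hom[OF assms(1,2)]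
            Y(1,3) one _ _ Z, of g] Inr
        by (auto simp: syllable_word_def free_product_generators_def)
    qed
    moreover have "w \<in> generate ?P ?Z"
      using Cons by (simp add: reduced_words_Cons)
    moreover have "s # w = [s] \<otimes>\<^bsub>?P\<^esub> w"
      using free_product_append[OF assms(1,2), of "[s]" w] Cons.prems by (simp add: free_product_def)
    ultimately show ?case by (simp add: generate.eng)
  qed
  ultimately show ?thesis
    using Z P.generate_incl[OF Z] by (auto simp: symmetric_generating_set_def carrier)
qed

section \<open>A normal form for the free product\<close>

text \<open>The marker tells the factor, so the alphabets of the two factors need not be disjoint.\<close>

primrec syllable_code :: "('g \<Rightarrow> nat list) \<Rightarrow> ('h \<Rightarrow> nat list) \<Rightarrow> 'g + 'h \<Rightarrow> nat list" where
  "syllable_code u v (Inl g) = 0 # u g"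
| "syllable_code u v (Inr h) = 1 # v h"

definition word_code :: "('g \<Rightarrow> nat list) \<Rightarrow> ('h \<Rightarrow> nat list) \<Rightarrow> ('g + 'h) list \<Rightarrow> nat list" where
  "word_code u v w = concat (map (syllable_code u v) w)"

lemma word_code_simps [simp]:
  "word_code u v [] = []"
  "word_code u v (s # w) = syllable_code u v s @ word_code u v w"
  "word_code u v (w @ w') = word_code u v w @ word_code u v w'"
  by (simp_all add: word_code_def)

text \<open>Since the codes of group elements avoid the markers, the code of the first syllable extends
  exactly to the next marker or to the end of the word.\<close>

lemma inj_on_word_code:
  assumes u: "inj_on u A" "\<And>g. g \<in> A \<Longrightarrow> set (u g) \<subseteq> {2..}"
    and v: "inj_on v B" "\<And>h. h \<in> B \<Longrightarrow> set (v h) \<subseteq> {2..}"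
  shows "inj_on (word_code u v) (lists (A <+> B))"
proof (rule inj_onI)
  fix w w' assume "w \<in> lists (A <+> B)" "w' \<in> lists (A <+> B)" "word_code u v w = word_code u v w'"
  then show "w = w'"
  proof (induction w arbitrary: w' rule: list.induct)
    case Nil
    then show ?case by (cases w'; cases "hd w'") auto
  next
    case (Cons s w)
    from Cons.prems(3) obtain s' t where w': "w' = s' # t"
      by (cases w'; cases s) auto
    have marker: "takeWhile ((\<le>) 2) (word_code u v z) = []" for z :: "('a + 'b) list"
      by (cases z; cases "hd z") auto
    have split: "x = y \<and> word_code u v w = word_code u v t"
      if eq: "x @ word_code u v w = y @ word_code u v t" and x: "set x \<subseteq> {2..}" and y: "set y \<subseteq> {2..}"
      for x y
    proof -
      have tw: "takeWhile ((\<le>) 2) (y @ word_code u v z) = y" if "set y \<subseteq> {2..}" for y z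
        using that marker by (subst takeWhile_append2) auto
      have "x = takeWhile ((\<le>) 2) (x @ word_code u v w)" using tw[OF x] by simp
      also have "\<dots> = y" unfolding eq using tw[OF y] .
      finally have "x = y" .
      with eq show ?thesis by simp
    qed
    have IH: "w = t" if "word_code u v w = word_code u v t"
      using Cons.IH[of t] Cons.prems(1,2) that by (simp add: w')
    show ?case
    proof (cases s)
      case (Inl g)
      with Cons.prems(3) obtain g' where s': "s' = Inl g'"
        by (cases s') (auto simp: w')
      from Cons.prems Inl s' have g: "g \<in> A" "g' \<in> A" by (auto simp: w')
      then have "u g = u g' \<and> word_code u v w = word_code u v t"
        using Cons.prems(3) by (intro split u(2)) (simp add: w' Inl s')
      then show ?thesis
        using IH inj_onD[OF u(1) _ g] by (simp add: w' Inl s')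
    next
      case (Inr h)
      with Cons.prems(3) obtain h' where s': "s' = Inr h'"
        by (cases s') (auto simp: w')
      from Cons.prems Inr s' have h: "h \<in> B" "h' \<in> B" by (auto simp: w')
      then have "v h = v h' \<and> word_code u v w = word_code u v t"
        using Cons.prems(3) by (intro split v(2)) (simp add: w' Inr s')
      then show ?thesis
        using IH inj_onD[OF v(1) _ h] by (simp add: w' Inr s')
    qed
  qed
qed

text \<open>The nodes record the factor of the last syllable: \<open>Some True\<close> for the left factor, \<open>Some False\<close>
  for the right one, and \<open>None\<close> before the first syllable.\<close>

definition code_edges :: "nat list set \<Rightarrow> nat list set \<Rightarrow> (bool option, nat) marked_edge set" where
  "code_edges A B = {(None, 0, A, Some True), (Some False, 0, A, Some True),
     (None, 1, B, Some False), (Some True, 1, B, Some False)}"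

text \<open>Paths spell codes of reduced words: the edges alternate between the factors. The identity has to
  be removed from the normal form of each factor because reduced words have nontrivial syllables.\<close>

lemma marked_path_code_edges:
  fixes G :: "('g, 'm) monoid_scheme" and H :: "('h, 'n) monoid_scheme"
  defines "E u v \<equiv> code_edges (u ` (carrier G - {\<one>\<^bsub>G\<^esub>})) (v ` (carrier H - {\<one>\<^bsub>H\<^esub>}))"
  shows "marked_path (E u v) p w q \<longleftrightarrow>
     (\<exists>s \<in> reduced_words G H. w = word_code u v s \<and> (s = [] \<or> p \<noteq> Some (isl (hd s))) \<and>
        q = (if s = [] then p else Some (isl (last s))))" (is "_ \<longleftrightarrow> ?rhs p w q")
proof
  assume "marked_path (E u v) p w q"
  then show "?rhs p w q"
  proof (induction rule: marked_path.induct)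
    case (marked_path_Nil p)
    then show ?case by (intro bexI[of _ "[]"]) auto
  next
    case (marked_path_edge p c L q x w r)
    then obtain s where s: "s \<in> reduced_words G H" "w = word_code u v s"
        "s = [] \<or> q \<noteq> Some (isl (hd s))" "r = (if s = [] then q else Some (isl (last s)))"
      by blast
    from marked_path_edge.hyps obtain t where t: "syllable G H t" "c # x = syllable_code u v t"
        "q = Some (isl t)" "p \<noteq> Some (isl t)"
    proof -
      assume that: "\<And>t. syllable G H t \<Longrightarrow> c # x = syllable_code u v t \<Longrightarrow>
        q = Some (isl t) \<Longrightarrow> p \<noteq> Some (isl t) \<Longrightarrow> thesis"
      from marked_path_edge.hyps(1) consider "c = 0" "q = Some True" "p \<noteq> Some True"
          "L = u ` (carrier G - {\<one>\<^bsub>G\<^esub>})"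
        | "c = 1" "q = Some False" "p \<noteq> Some False" "L = v ` (carrier H - {\<one>\<^bsub>H\<^esub>})"
        unfolding E_def code_edges_def by blast
      then show thesis
      proof cases
        case 1
        with marked_path_edge.hyps(2) obtain g where "x = u g" "g \<in> carrier G" "g \<noteq> \<one>\<^bsub>G\<^esub>" by auto
        with 1 show thesis by (intro that[of "Inl g"]) auto
      next
        case 2
        with marked_path_edge.hyps(2) obtain h where "x = v h" "h \<in> carrier H" "h \<noteq> \<one>\<^bsub>H\<^esub>" by auto
        with 2 show thesis by (intro that[of "Inr h"]) auto
      qed
    qed
    have "c # x @ w = word_code u v (t # s)"
      using t(2) s(2) by (simp flip: append_Cons)
    with s t show ?case
      by (intro bexI[of _ "t # s"]) (auto simp: reduced_words_Cons)
  qed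
next
  assume "?rhs p w q"
  then obtain s where "s \<in> reduced_words G H" "s = [] \<or> p \<noteq> Some (isl (hd s))"
      "q = (if s = [] then p else Some (isl (last s)))" and w: "w = word_code u v s" by blast
  from this(1-3) have "marked_path (E u v) p (word_code u v s) q"
  proof (induction s arbitrary: p)
    case Nil
    then show ?case by (simp add: marked_path_Nil)
  next
    case (Cons t s)
    have IH: "marked_path (E u v) (Some (isl t)) (word_code u v s) q"
      using Cons.prems by (intro Cons.IH) (auto simp: reduced_words_Cons)
    have p: "p = None \<or> p = Some (\<not> isl t)"
      using Cons.prems(2) by (cases p) auto
    have "marked_path (E u v) p (syllable_code u v t) (Some (isl t))"
    proof (cases t)
      case (Inl g)
      with Cons.prems(1) p have "(p, 0, u ` (carrier G - {\<one>\<^bsub>G\<^esub>}), Some True) \<in> E u v"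
          "u g \<in> u ` (carrier G - {\<one>\<^bsub>G\<^esub>})"
        by (auto simp: E_def code_edges_def reduced_words_Cons)
      with Inl show ?thesis using marked_path_single_edge by fastforce
    next
      case (Inr h)
      with Cons.prems(1) p have "(p, 1, v ` (carrier H - {\<one>\<^bsub>H\<^esub>}), Some False) \<in> E u v"
          "v h \<in> v ` (carrier H - {\<one>\<^bsub>H\<^esub>})"
        by (auto simp: E_def code_edges_def reduced_words_Cons)
      with Inr show ?thesis using marked_path_single_edge by fastforce
    qed
    from marked_path_append[OF this IH] show ?case by simp
  qed
  with w show "marked_path (E u v) p w q" by simp
qed

section \<open>Right multiplication by a generator of one factor\<close>

text \<open>In the application, \<open>K\<close> is one of the two factors, \<open>\<iota>\<close> its injection into the syllables, \<open>m\<close> its marker, \<open>P\<close> the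
  set of reduced words that do not end in \<open>K\<close>, and \<open>rmul\<close> right multiplication by \<open>\<iota> x\<close>. Writing a word
  as \<open>p\<close> or \<open>p @ [\<iota> g]\<close> with \<open>p \<in> P\<close>, the convolution is the diagonal word over the code of \<open>p\<close> followed
  by one of three things: a new syllable \<open>x\<close> appears, the syllable \<open>g = x\<^sup>-\<^sup>1\<close> disappears, or \<open>g\<close> is
  replaced by \<open>g x\<close>, with both different from the identity. The first two are single words. The third is
  the multiplication language of \<open>K\<close> without the two pairs in which the identity occurs.\<close>

lemma right_multiplication_in_counter_languages:
  fixes K :: "('c, 'm) monoid_scheme" and \<iota> :: "'c \<Rightarrow> 's" and code :: "'s list \<Rightarrow> 'a list"
    and E :: "('v, 'a) marked_edge set"
  assumes K: "group K" "bij_betw \<phi> L (carrier K)" "x \<in> carrier K" "x \<noteq> \<one>\<^bsub>K\<^esub>"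
    and Lx: "{convolution u v | u v. u \<in> L \<and> v \<in> L \<and> \<phi> v = \<phi> u \<otimes>\<^bsub>K\<^esub> x} \<in> counter_languages k"
    and E: "finite E" "\<And>p c L q. (p, c, L, q) \<in> E \<Longrightarrow> L \<in> counter_languages k"
    and P: "finite F" "code ` P = {w. \<exists>q \<in> F. marked_path E s w q}"
    and W: "W = P \<union> {p @ [\<iota> g] | p g. p \<in> P \<and> g \<in> carrier K \<and> g \<noteq> \<one>\<^bsub>K\<^esub>}"
    and code: "\<And>p g. code (p @ [\<iota> g]) = code p @ m # inv_into L \<phi> g"
    and rmul: "\<And>p. p \<in> P \<Longrightarrow> rmul p = p @ [\<iota> x]"
      "\<And>p g. p \<in> P \<Longrightarrow> g \<in> carrier K \<Longrightarrow> g \<noteq> \<one>\<^bsub>K\<^esub> \<Longrightarrow>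
         rmul (p @ [\<iota> g]) = (if g \<otimes>\<^bsub>K\<^esub> x = \<one>\<^bsub>K\<^esub> then p else p @ [\<iota> (g \<otimes>\<^bsub>K\<^esub> x)])"
  shows "{convolution (code w) (code (rmul w)) | w. w \<in> W} \<in> counter_languages k"
proof -
  interpret K: group K by fact
  define u where "u = inv_into L \<phi>"
  have u: "u g \<in> L" "\<phi> (u g) = g" if "g \<in> carrier K" for g
    using bij_betw_inv_into_right[OF K(2) that] bij_betwE[OF bij_betw_inv_into[OF K(2)]] that
    by (auto simp: u_def)
  have u_\<phi>: "u (\<phi> v) = v" "\<phi> v \<in> carrier K" if "v \<in> L" for v
    using bij_betw_inv_into_left[OF K(2) that] bij_betwE[OF K(2)] that by (auto simp: u_def)
  have u_eq: "u g = u h \<longleftrightarrow> g = h" if "g \<in> carrier K" "h \<in> carrier K" for g h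
    using u(2) that by metis
  have x_inv: "g \<otimes>\<^bsub>K\<^esub> x = \<one>\<^bsub>K\<^esub> \<longleftrightarrow> g = inv\<^bsub>K\<^esub> x" if "g \<in> carrier K" for g
    using K.inv_equality[of g x] that K(3) by auto
  let ?Lx = "{convolution u v | u v. u \<in> L \<and> v \<in> L \<and> \<phi> v = \<phi> u \<otimes>\<^bsub>K\<^esub> x}"
  define R where "R = ?Lx - {convolution (u \<one>\<^bsub>K\<^esub>) (u x), convolution (u (inv\<^bsub>K\<^esub> x)) (u \<one>\<^bsub>K\<^esub>)}"
  have "?Lx = {convolution (u g) (u (g \<otimes>\<^bsub>K\<^esub> x)) | g. g \<in> carrier K}"
  proof (intro equalityI subsetI)
    fix z assume "z \<in> ?Lx"
    then obtain v w where "z = convolution v w" "v \<in> L" "w \<in> L" "\<phi> w = \<phi> v \<otimes>\<^bsub>K\<^esub> x" by blast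
    with u_\<phi> show "z \<in> {convolution (u g) (u (g \<otimes>\<^bsub>K\<^esub> x)) | g. g \<in> carrier K}"
      by (intro CollectI exI[of _ "\<phi> v"]) metis
  next
    fix z assume "z \<in> {convolution (u g) (u (g \<otimes>\<^bsub>K\<^esub> x)) | g. g \<in> carrier K}"
    then obtain g where g: "z = convolution (u g) (u (g \<otimes>\<^bsub>K\<^esub> x))" "g \<in> carrier K" by blast
    then have "u g \<in> L" "u (g \<otimes>\<^bsub>K\<^esub> x) \<in> L" "\<phi> (u (g \<otimes>\<^bsub>K\<^esub> x)) = \<phi> (u g) \<otimes>\<^bsub>K\<^esub> x"
      using u K(3) by simp_all
    with g(1) show "z \<in> ?Lx" by blast
  qed
  then have R: "R = {convolution (u g) (u (g \<otimes>\<^bsub>K\<^esub> x)) | g.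
      g \<in> carrier K \<and> g \<noteq> \<one>\<^bsub>K\<^esub> \<and> g \<otimes>\<^bsub>K\<^esub> x \<noteq> \<one>\<^bsub>K\<^esub>}"
    using K(3) by (auto simp: R_def convolution_eq_iff u_eq x_inv)
  have R_in: "R \<in> counter_languages k"
    unfolding R_def using Lx by (rule counter_languages_Diff_finite) simp

  let ?d = "\<lambda>a. (Some a, Some a)"
  \<comment> \<open>The diagonal of the prefixes is read by relabelling the edges, and the three cases become
    last edges, which are told apart by their first letter.\<close>
  define E' where "E' = (\<lambda>(p, c, L, q). (p, ?d c, map ?d ` L, q)) ` E"
  define T where "T = {((None, Some m), {convolution [] (u x)}),
     ((Some m, None), {convolution (u (inv\<^bsub>K\<^esub> x)) []}), (?d m, R)}"
  have prefix: "(\<exists>q \<in> F. marked_path E' s w q) \<longleftrightarrow> (\<exists>p \<in> P. w = map ?d (code p))" for w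
  proof -
    have "(\<exists>p \<in> P. w = map ?d (code p)) \<longleftrightarrow> (\<exists>v \<in> code ` P. w = map ?d v)" by simp
    also have "\<dots> \<longleftrightarrow> (\<exists>q \<in> F. \<exists>v. w = map ?d v \<and> marked_path E s v q)" unfolding P(2) by blast
    finally show ?thesis unfolding E'_def marked_path_image by simp
  qed
  have "{convolution (code w) (code (rmul w)) | w. w \<in> W} =
     {map ?d (code p) @ c # z | p c L z. p \<in> P \<and> (c, L) \<in> T \<and> z \<in> L}" (is "?A = ?B")
  proof (intro equalityI subsetI)
    fix z assume "z \<in> ?A"
    then obtain w where w: "w \<in> W" "z = convolution (code w) (code (rmul w))" by blast
    from w(1) consider "w \<in> P"
      | p g where "w = p @ [\<iota> g]" "p \<in> P" "g \<in> carrier K" "g \<noteq> \<one>\<^bsub>K\<^esub>" "g \<otimes>\<^bsub>K\<^esub> x = \<one>\<^bsub>K\<^esub>"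
      | p g where "w = p @ [\<iota> g]" "p \<in> P" "g \<in> carrier K" "g \<noteq> \<one>\<^bsub>K\<^esub>" "g \<otimes>\<^bsub>K\<^esub> x \<noteq> \<one>\<^bsub>K\<^esub>"
      unfolding W by blast
    then show "z \<in> ?B"
    proof cases
      case 1
      then have "z = map ?d (code w) @ (None, Some m) # convolution [] (u x)"
        using convolution_common_prefix[of "code w" "[]"] by (simp add: w(2) rmul(1) code u_def)
      with 1 show ?thesis unfolding T_def by blast
    next
      case 2
      then have "z = map ?d (code p) @ (Some m, None) # convolution (u (inv\<^bsub>K\<^esub> x)) []"
        using convolution_common_prefix[of "code p" _ "[]"] x_inv[of g]
        by (simp add: w(2) rmul(2) code u_def)
      with 2 show ?thesis unfolding T_def by blast
    next
      case 3
      then have "z = map ?d (code p) @ ?d m # convolution (u g) (u (g \<otimes>\<^bsub>K\<^esub> x))"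
        by (simp add: w(2) rmul(2) code u_def convolution_common_prefix)
      moreover have "convolution (u g) (u (g \<otimes>\<^bsub>K\<^esub> x)) \<in> R"
        using 3 unfolding R by blast
      ultimately show ?thesis using 3(2) unfolding T_def by blast
    qed
  next
    fix z assume "z \<in> ?B"
    then obtain p c L' y where z: "z = map ?d (code p) @ c # y" "p \<in> P" "(c, L') \<in> T" "y \<in> L'"
      by blast
    from z(3,4) consider "c = (None, Some m)" "y = convolution [] (u x)"
      | "c = (Some m, None)" "y = convolution (u (inv\<^bsub>K\<^esub> x)) []"
      | g where "c = ?d m" "y = convolution (u g) (u (g \<otimes>\<^bsub>K\<^esub> x))"
          "g \<in> carrier K" "g \<noteq> \<one>\<^bsub>K\<^esub>" "g \<otimes>\<^bsub>K\<^esub> x \<noteq> \<one>\<^bsub>K\<^esub>"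
      unfolding T_def R by blast
    then show "z \<in> ?A"
    proof cases
      case 1
      then have "z = convolution (code p) (code (rmul p))"
        using convolution_common_prefix[of "code p" "[]"] z(2) by (simp add: z(1) rmul(1) code u_def)
      with z(2) show ?thesis unfolding W by blast
    next
      case 2
      have i: "inv\<^bsub>K\<^esub> x \<in> carrier K" "inv\<^bsub>K\<^esub> x \<noteq> \<one>\<^bsub>K\<^esub>" "inv\<^bsub>K\<^esub> x \<otimes>\<^bsub>K\<^esub> x = \<one>\<^bsub>K\<^esub>"
        using K(3,4) by auto
      then have "z = convolution (code (p @ [\<iota> (inv\<^bsub>K\<^esub> x)])) (code (rmul (p @ [\<iota> (inv\<^bsub>K\<^esub> x)])))"
        using convolution_common_prefix[of "code p" _ "[]"] z(2) 2
        by (simp add: z(1) rmul(2) code u_def)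
      with z(2) i show ?thesis unfolding W by blast
    next
      case 3
      then have "z = convolution (code (p @ [\<iota> g])) (code (rmul (p @ [\<iota> g])))"
        using z(2) by (simp add: z(1) rmul(2) code u_def convolution_common_prefix)
      with z(2) 3 show ?thesis unfolding W by blast
    qed
  qed
  also have "\<dots> = {w @ c # z | w c L z. (\<exists>q \<in> F. marked_path E' s w q) \<and> (c, L) \<in> T \<and> z \<in> L}"
    unfolding prefix by blast
  also have "\<dots> \<in> counter_languages k"
  proof (rule marked_path_last_edge_in_counter_languages)
    show "L \<in> counter_languages k" if "(p, c, L, q) \<in> E'" for p c L q
      using that E(2) by (auto simp: E'_def intro: counter_languages_image)
    show "L \<in> counter_languages k" if "(c, L) \<in> T" for c L
      using that R_in by (auto simp: T_def singleton_in_counter_languages)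
  qed (use E(1) P(1) in \<open>auto simp: E'_def T_def\<close>)
  finally show ?thesis .
qed

section \<open>Free products of counter graph automatic groups\<close>

theorem lemma5p3:
  fixes G :: "('g, 'm) monoid_scheme" and H :: "('h, 'n) monoid_scheme"
    and X :: "'g set" and Y :: "'h set"
    and \<Lambda> :: "'a set" and \<Gamma> :: "'b set"
    and k l :: nat
  assumes "group G" and "group H"
    and "symmetric_generating_set G X" and "symmetric_generating_set H Y"
    and "finite \<Lambda>" and "finite \<Gamma>"
    and "counter_graph_automatic k G X \<Lambda>"
    and "counter_graph_automatic l H Y \<Gamma>"
  shows "counter_graph_automatic_group (max k l) (free_product G H)"
proof -
  interpret G: group G by fact
  interpret H: group H by fact
  let ?P = "free_product G H" and ?RW = "reduced_words G H"
  define K where "K = max k l"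
  then have "k \<le> K" "l \<le> K" by simp_all
  obtain \<Lambda>' :: "nat set" and A \<phi> where A: "finite \<Lambda>'" "\<Lambda>' \<subseteq> {2..}" "A \<subseteq> lists \<Lambda>'"
      "bij_betw \<phi> A (carrier G)" "A \<in> counter_languages K"
      "\<And>x. x \<in> X \<Longrightarrow> {convolution u v | u v. u \<in> A \<and> v \<in> A \<and> \<phi> v = \<phi> u \<otimes>\<^bsub>G\<^esub> x} \<in> counter_languages K"
    by (rule counter_graph_automatic_nat_alphabet[OF assms(5,7) \<open>k \<le> K\<close>]) (rule that)
  obtain \<Gamma>' :: "nat set" and B \<psi> where B: "finite \<Gamma>'" "\<Gamma>' \<subseteq> {2..}" "B \<subseteq> lists \<Gamma>'"
      "bij_betw \<psi> B (carrier H)" "B \<in> counter_languages K"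
      "\<And>x. x \<in> Y \<Longrightarrow> {convolution u v | u v. u \<in> B \<and> v \<in> B \<and> \<psi> v = \<psi> u \<otimes>\<^bsub>H\<^esub> x} \<in> counter_languages K"
    by (rule counter_graph_automatic_nat_alphabet[OF assms(6,8) \<open>l \<le> K\<close>]) (rule that)
  define u v where "u = inv_into A \<phi>" and "v = inv_into B \<psi>"
  have u: "bij_betw u (carrier G) A" and v: "bij_betw v (carrier H) B"
    unfolding u_def v_def by (intro bij_betw_inv_into A(4) B(4))+
  let ?A = "u ` (carrier G - {\<one>\<^bsub>G\<^esub>})" and ?B = "v ` (carrier H - {\<one>\<^bsub>H\<^esub>})"
  have "?A = A - {u \<one>\<^bsub>G\<^esub>}" "?B = B - {v \<one>\<^bsub>H\<^esub>}"
    using u v inj_on_image_set_diff[of u "carrier G" "carrier G" "{\<one>\<^bsub>G\<^esub>}"]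
      inj_on_image_set_diff[of v "carrier H" "carrier H" "{\<one>\<^bsub>H\<^esub>}"]
    by (auto simp: bij_betw_def)
  then have AB: "?A \<in> counter_languages K" "?B \<in> counter_languages K"
    using A(5) B(5) by (simp_all add: counter_languages_Diff_finite)
  define E where "E = code_edges ?A ?B"
  have E: "finite E" "\<And>p c L q. (p, c, L, q) \<in> E \<Longrightarrow> L \<in> counter_languages K"
    using AB by (auto simp: E_def code_edges_def)
  note path = marked_path_code_edges[where u = u and v = v and G = G and H = H, folded E_def]
  define code where "code = word_code u v"
  define end_node :: "('g + 'h) list \<Rightarrow> bool option"
    where "end_node s = (if s = [] then None else Some (isl (last s)))" for s
  have code_path: "marked_path E None w q \<longleftrightarrow> (\<exists>s \<in> ?RW. w = code s \<and> q = end_node s)" for w q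
    unfolding path code_def end_node_def by simp
  have code_paths: "code ` {s \<in> ?RW. end_node s \<in> F} = {w. \<exists>q \<in> F. marked_path E None w q}" for F
    unfolding code_path by blast

  define N where "N = code ` ?RW"
  define \<chi> where "\<chi> = inv_into ?RW code"
  have u_letters: "set (u g) \<subseteq> \<Lambda>'" if "g \<in> carrier G" for g
    using bij_betwE[OF u] that A(3) by (auto simp: in_lists_conv_set)
  have v_letters: "set (v h) \<subseteq> \<Gamma>'" if "h \<in> carrier H" for h
    using bij_betwE[OF v] that B(3) by (auto simp: in_lists_conv_set)
  have syllables: "set s \<subseteq> carrier G <+> carrier H" if "s \<in> ?RW" for s
  proof
    fix t assume "t \<in> set s"
    with that have "syllable G H t" by (auto simp: reduced_words_def)
    then show "t \<in> carrier G <+> carrier H" by (cases t) auto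
  qed
  have "inj_on (word_code u v) (lists (carrier G <+> carrier H))"
    using u v u_letters v_letters A(2) B(2)
    by (intro inj_on_word_code) (blast dest: bij_betw_imp_inj_on)+
  moreover have "?RW \<subseteq> lists (carrier G <+> carrier H)"
    using syllables by (simp add: subset_iff in_lists_conv_set)
  ultimately have inj: "inj_on code ?RW"
    unfolding code_def by (rule inj_on_subset)
  have \<chi>: "\<chi> (code s) = s" if "s \<in> ?RW" for s
    using inj that by (simp add: \<chi>_def)
  have carrier: "carrier ?P = ?RW" by (simp add: free_product_def)
  have "bij_betw \<chi> N (carrier ?P)"
    unfolding \<chi>_def N_def carrier by (intro bij_betw_inv_into inj_on_imp_bij_betw inj)
  moreover have "N \<subseteq> lists ({0, 1} \<union> \<Lambda>' \<union> \<Gamma>')"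
  proof -
    have "set (code s) \<subseteq> {0, 1} \<union> \<Lambda>' \<union> \<Gamma>'" if "set s \<subseteq> carrier G <+> carrier H" for s
      using that
    proof (induction s)
      case (Cons t s)
      then show ?case
        by (cases t) (auto simp: code_def dest!: subsetD[OF u_letters] subsetD[OF v_letters])
    qed (simp add: code_def)
    then show ?thesis using syllables by (auto simp: N_def in_lists_conv_set)
  qed
  moreover have "N \<in> counter_languages K"
    using marked_path_language_in_counter_languages[OF E, where F = UNIV and s = None] code_paths[of UNIV]
    by (simp add: N_def)
  moreover have "{convolution w w' | w w'. w \<in> N \<and> w' \<in> N \<and> \<chi> w' = \<chi> w \<otimes>\<^bsub>?P\<^esub> z} \<in> counter_languages K"
    if z: "z \<in> free_product_generators G H X Y" for z
  proof -
    interpret P: group ?P using assms(1,2) by (rule group_free_product)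
    have X: "X \<subseteq> carrier G" and Y: "Y \<subseteq> carrier H"
      using assms(3,4) by (auto simp: symmetric_generating_set_def)
    have "z \<in> carrier ?P"
      using z symmetric_free_product_generators[OF assms(1-4)]
      by (auto simp: symmetric_generating_set_def)
    then have closed: "s \<otimes>\<^bsub>?P\<^esub> z \<in> ?RW" if "s \<in> ?RW" for s
      using that P.m_closed by (simp add: carrier)
    have "{convolution w w' | w w'. w \<in> N \<and> w' \<in> N \<and> \<chi> w' = \<chi> w \<otimes>\<^bsub>?P\<^esub> z} =
        {convolution (code s) (code (s \<otimes>\<^bsub>?P\<^esub> z)) | s. s \<in> ?RW}" (is "?L = ?R")
    proof (intro equalityI subsetI)
      fix y assume "y \<in> ?L"
      then obtain s s' where "y = convolution (code s) (code s')" "s \<in> ?RW" "s' \<in> ?RW"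
          "\<chi> (code s') = \<chi> (code s) \<otimes>\<^bsub>?P\<^esub> z"
        unfolding N_def by blast
      then show "y \<in> ?R" by (auto simp: \<chi>)
    next
      fix y assume "y \<in> ?R"
      then obtain s where s: "y = convolution (code s) (code (s \<otimes>\<^bsub>?P\<^esub> z))" "s \<in> ?RW" by blast
      moreover have "\<chi> (code (s \<otimes>\<^bsub>?P\<^esub> z)) = \<chi> (code s) \<otimes>\<^bsub>?P\<^esub> z"
        using s(2) closed by (simp add: \<chi>)
      ultimately show "y \<in> ?L"
        unfolding N_def using closed by blast
    qed
    also have "\<dots> \<in> counter_languages K"
    proof -
      from z consider x where "z = [Inl x]" "x \<in> X" "x \<noteq> \<one>\<^bsub>G\<^esub>"
        | y where "z = [Inr y]" "y \<in> Y" "y \<noteq> \<one>\<^bsub>H\<^esub>"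
        unfolding free_product_generators_def by blast
      then show ?thesis
      proof cases
        case 1
        then have x: "x \<in> carrier G" using X by blast
        show ?thesis
          unfolding 1(1)
        proof (rule right_multiplication_in_counter_languages[where code = code and \<iota> = Inl
              and rmul = "\<lambda>s. s \<otimes>\<^bsub>?P\<^esub> [Inl x]", OF assms(1) A(4) x 1(3) A(6)[OF 1(2)]
              E _ _ reduced_words_split_last(1)])
          show "finite {None, Some False}" by simp
          show "code ` {p \<in> ?RW. p = [] \<or> \<not> isl (last p)} =
              {w. \<exists>q \<in> {None, Some False}. marked_path E None w q}"
            unfolding code_paths[symmetric]
            by (rule arg_cong[where f = "image code"]) (auto simp: end_node_def)
          show "code (p @ [Inl g]) = code p @ 0 # inv_into A \<phi> g" for p g
            by (simp add: code_def u_def)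
          show "p \<otimes>\<^bsub>?P\<^esub> [Inl x] = p @ [Inl x]"
            if "p \<in> {p \<in> ?RW. p = [] \<or> \<not> isl (last p)}" for p
            using that free_product_mult_snoc_Inl(1)[OF assms(1,2) _ _ x 1(3), of p] by simp
          show "(p @ [Inl g]) \<otimes>\<^bsub>?P\<^esub> [Inl x] =
              (if g \<otimes>\<^bsub>G\<^esub> x = \<one>\<^bsub>G\<^esub> then p else p @ [Inl (g \<otimes>\<^bsub>G\<^esub> x)])"
            if "p \<in> {p \<in> ?RW. p = [] \<or> \<not> isl (last p)}" "g \<in> carrier G" "g \<noteq> \<one>\<^bsub>G\<^esub>"
            for p g
            using that free_product_mult_snoc_Inl(2)[OF assms(1,2) _ _ x 1(3), of p g] by simp
        qed
      next
        case 2
        then have y: "y \<in> carrier H" using Y by blast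
        show ?thesis
          unfolding 2(1)
        proof (rule right_multiplication_in_counter_languages[where code = code and \<iota> = Inr
              and rmul = "\<lambda>s. s \<otimes>\<^bsub>?P\<^esub> [Inr y]", OF assms(2) B(4) y 2(3) B(6)[OF 2(2)]
              E _ _ reduced_words_split_last(2)])
          show "finite {None, Some True}" by simp
          show "code ` {p \<in> ?RW. p = [] \<or> isl (last p)} =
              {w. \<exists>q \<in> {None, Some True}. marked_path E None w q}"
            unfolding code_paths[symmetric]
            by (rule arg_cong[where f = "image code"]) (auto simp: end_node_def)
          show "code (p @ [Inr g]) = code p @ 1 # inv_into B \<psi> g" for p g
            by (simp add: code_def v_def)
          show "p \<otimes>\<^bsub>?P\<^esub> [Inr y] = p @ [Inr y]"
            if "p \<in> {p \<in> ?RW. p = [] \<or> isl (last p)}" for p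
            using that free_product_mult_snoc_Inr(1)[OF assms(1,2) _ _ y 2(3), of p] by simp
          show "(p @ [Inr g]) \<otimes>\<^bsub>?P\<^esub> [Inr y] =
              (if g \<otimes>\<^bsub>H\<^esub> y = \<one>\<^bsub>H\<^esub> then p else p @ [Inr (g \<otimes>\<^bsub>H\<^esub> y)])"
            if "p \<in> {p \<in> ?RW. p = [] \<or> isl (last p)}" "g \<in> carrier H" "g \<noteq> \<one>\<^bsub>H\<^esub>"
            for p g
            using that free_product_mult_snoc_Inr(2)[OF assms(1,2) _ _ y 2(3), of p g] by simp
        qed
      qed
    qed
    finally show ?thesis .
  qed
  ultimately have aut: "counter_graph_automatic K ?P (free_product_generators G H X Y) ({0, 1} \<union> \<Lambda>' \<union> \<Gamma>')"
    unfolding counter_graph_automatic_def normal_form_def by blast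
  have fin: "finite ({0, 1} \<union> \<Lambda>' \<union> \<Gamma>')"
    using A(1) B(1) by simp
  show ?thesis
    unfolding counter_graph_automatic_group_def K_def[symmetric]
  proof (intro conjI exI)
    show "group ?P" using assms(1,2) by (rule group_free_product)
    show "symmetric_generating_set ?P (free_product_generators G H X Y)"
      using assms(1-4) by (rule symmetric_free_product_generators)
  qed (fact fin, fact aut)
qed

end
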